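(* Let $\alpha\in\mathbb{R}$, let $a(z)=\sum_{n=1}^\infty a_nz^n$ be a nonzero holomorphic function on $\Delta_{\epsilon_0}$ ($\epsilon_0>0$), and let $p:(0,\epsilon_0)\to\mathbb{R}$ and $q:[0,\epsilon_0)\to\mathbb{R}$ be $\mathcal{C}^1$-smooth functions such that $q(0)=0$, the function $g$ given by $g(z)=e^{p(|z|)}$ for $0<|z|<\epsilon_0$ and $g(0)=0$ is $\mathcal{C}^1$-smooth, $g$ and $g'$ are flat at $0$, and the function $R(z_2)=q(|z_2|)-\mathrm{Re}\big(\sum_{n=1}^\infty\frac{a_n}{n}z_2^n\big)$ is $\mathcal{C}^1$-smooth near $0$. Let $M(a,\alpha,p,q)$ be the associated real hypersurface germ at $(0,0)\in\mathbb{C}^2$ and $H^{a,\alpha}$ the associated holomorphic vector field, both defined in the context. Then $$\mathrm{hol}_0\big(M(a,\alpha,p,q),0\big)=\{\beta H^{a,\alpha}:\beta\in\mathbb{R}\}.$$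
   Context: Notation: $\Delta_r=\{z\in\mathbb{C}:|z|<r\}$, $\Delta_r^*=\Delta_r\setminus\{0\}$; $g'(z)=\frac{\partial g}{\partial z}(z)$ is the Wirtinger derivative. A complex-valued function $f$ defined near $0\in\mathbb{C}$ is flat at $0$ if for each $n\in\mathbb{N}$ there exist $C,\epsilon>0$ (depending on $n$) with $|f(z)|\le C|z|^n$ for all $|z|<\epsilon$. Definition of $M(a,\alpha,p,q)$: it is the germ at $(0,0)$ of the real hypersurface $$\rho(z_1,z_2):=\mathrm{Re}\,z_1+P(z_2)+f(z_2,\mathrm{Im}\,z_1)=0,$$ where, with $R(z_2)=q(|z_2|)-\mathrm{Re}\big(\sum_{n=1}^\infty\frac{a_n}{n}z_2^n\big)$, for $z_2\in\Delta_{\epsilon_0}$ and $t\in(-\delta_0,\delta_0)$ (with $\delta_0>0$ small enough, and $\epsilon_0$ shrunk if necessary so that the expressions below are defined), $$f(z_2,t)=\begin{cases}-\frac1\alpha\log\Big|\frac{\cos(R(z_2)+\alpha t)}{\cos(R(z_2))}\Big| & \text{if }\alpha\neq0,\\ \tan(R(z_2))\,t & \text{if }\alpha=0,\end{cases}\qquad P(z_2)=\begin{cases}\frac1\alpha\log\big[1+\alpha P_1(z_2)\big] & \text{if }\alpha\neq0,\\ P_1(z_2) & \text{if }\alpha=0,\end{cases}$$ and $$P_1(z_2)=\exp\Big[p(|z_2|)+\mathrm{Re}\Big(\sum_{n=1}^\infty\frac{a_n}{in}z_2^n\Big)-\log\big|\cos(R(z_2))\big|\Big]\ \text{ for } z_2\in\Delta_{\epsilon_0}^*,\qquad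 P_1(0)=0.$$ Definition of $H^{a,\alpha}$: $$H^{a,\alpha}(z_1,z_2)=L^\alpha(z_1)a(z_2)\frac{\partial}{\partial z_1}+iz_2\frac{\partial}{\partial z_2},\qquad L^\alpha(z_1)=\begin{cases}\frac1\alpha\big(\exp(\alpha z_1)-1\big) & \text{if }\alpha\neq0,\\ z_1 & \text{if }\alpha=0.\end{cases}$$ For a real $\mathcal{C}^1$-smooth hypersurface germ $(M,0)$ in $\mathbb{C}^2$, $M=\{\rho=0\}$, a holomorphic vector field germ $H=h_1\frac{\partial}{\partial z_1}+h_2\frac{\partial}{\partial z_2}$ at $0$ is tangent to $M$ if $(\mathrm{Re}\,H)\rho=0$ on $M$, i.e. $\mathrm{Re}\big[h_1\rho_{z_1}+h_2\rho_{z_2}\big]=0$ at all points of $M$ near $0$. $\mathrm{hol}_0(M,0)$ denotes the real vector space of holomorphic vector field germs at $0$ vanishing at $0$ which are tangent to $M$. *)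

theory Defs
  imports "HOL-Complex_Analysis.Complex_Analysis"
begin

text \<open>The one-sided derivative is meant at boundary points of \<open>S\<close>, e.g. at \<open>0\<close> for
  \<open>S = {0..<e}\<close>; for open \<open>S\<close> the restriction \<open>within S\<close> is void.\<close>

definition C1_smooth_on ::
    "'a::real_normed_vector set \<Rightarrow> ('a \<Rightarrow> 'b::real_normed_vector) \<Rightarrow> bool" where
  "C1_smooth_on S f \<longleftrightarrow>
     (\<exists>D :: 'a \<Rightarrow> 'a \<Rightarrow>\<^sub>L 'b.
        (\<forall>x\<in>S. (f has_derivative blinfun_apply (D x)) (at x within S)) \<and> continuous_on S D)"

definition C1_smooth_near ::
    "'a::real_normed_vector \<Rightarrow> ('a \<Rightarrow> 'b::real_normed_vector) \<Rightarrow> bool" where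
  "C1_smooth_near x f \<longleftrightarrow> (\<exists>U. open U \<and> x \<in> U \<and> C1_smooth_on U f)"

definition flat_at_0 :: "(complex \<Rightarrow> complex) \<Rightarrow> bool" where
  "flat_at_0 f \<longleftrightarrow>
     (\<forall>n::nat. \<exists>C>0. \<exists>\<epsilon>>0. \<forall>z. norm z < \<epsilon> \<longrightarrow> norm (f z) \<le> C * norm z ^ n)"

text \<open>The Wirtinger derivative \<open>(1/2) (\<partial>/\<partial>x - \<i> \<partial>/\<partial>y)\<close> with respect to \<open>z = x + \<i> y\<close>.\<close>

definition wirtinger :: "(complex \<Rightarrow> complex) \<Rightarrow> complex \<Rightarrow> complex" where
  "wirtinger f z =
     (vector_derivative (\<lambda>t::real. f (z + of_real t)) (at 0)
      - \<i> * vector_derivative (\<lambda>t::real. f (z + \<i> * of_real t)) (at 0)) / 2"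

definition wirtinger1 :: "(complex \<times> complex \<Rightarrow> real) \<Rightarrow> complex \<times> complex \<Rightarrow> complex" where
  "wirtinger1 \<rho> z = wirtinger (\<lambda>w. of_real (\<rho> (w, snd z))) (fst z)"

definition wirtinger2 :: "(complex \<times> complex \<Rightarrow> real) \<Rightarrow> complex \<times> complex \<Rightarrow> complex" where
  "wirtinger2 \<rho> z = wirtinger (\<lambda>w. of_real (\<rho> (fst z, w))) (snd z)"

definition holomorphic_near_0 :: "(complex \<times> complex \<Rightarrow> complex) \<Rightarrow> bool" where
  "holomorphic_near_0 f \<longleftrightarrow>
     (\<exists>U. open U \<and> 0 \<in> U \<and>
        (\<forall>z\<in>U. \<exists>A B. (f has_derivative (\<lambda>(u, v). A * u + B * v)) (at z)))"

text \<open>A vector field \<open>h\<^sub>1 \<partial>/\<partial>z\<^sub>1 + h\<^sub>2 \<partial>/\<partial>z\<^sub>2\<close> is represented by the map \<open>(h\<^sub>1, h\<^sub>2)\<close>, its germ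
  at the origin by the class of all maps agreeing with it near the origin.\<close>

type_synonym vector_field = "complex \<times> complex \<Rightarrow> complex \<times> complex"

definition germ_0 :: "vector_field \<Rightarrow> vector_field set" where
  "germ_0 H = {K. \<forall>\<^sub>F z in nhds 0. K z = H z}"

definition tangent_0 :: "vector_field \<Rightarrow> (complex \<times> complex \<Rightarrow> real) \<Rightarrow> bool" where
  "tangent_0 H \<rho> \<longleftrightarrow>
     (\<forall>\<^sub>F z in nhds 0. \<rho> z = 0 \<longrightarrow>
        Re (fst (H z) * wirtinger1 \<rho> z + snd (H z) * wirtinger2 \<rho> z) = 0)"

text \<open>The hypersurface germ \<open>{\<rho> = 0}\<close> is given by its defining function \<open>\<rho>\<close>.\<close>

definition hol_0 :: "(complex \<times> complex \<Rightarrow> real) \<Rightarrow> vector_field set set" where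
  "hol_0 \<rho> = {germ_0 H | H.
     holomorphic_near_0 (fst \<circ> H) \<and> holomorphic_near_0 (snd \<circ> H) \<and> H 0 = 0 \<and> tangent_0 H \<rho>}"

text \<open>In the following \<open>c n\<close> is the Taylor coefficient \<open>a\<^sub>n\<close>; all series start at \<open>n = 1\<close>,
  so \<open>c 0\<close> is never used.\<close>

definition R_fun :: "(nat \<Rightarrow> complex) \<Rightarrow> (real \<Rightarrow> real) \<Rightarrow> complex \<Rightarrow> real" where
  "R_fun c q z = q (norm z) - Re (\<Sum>n. c (Suc n) / of_nat (Suc n) * z ^ Suc n)"

definition g_fun :: "(real \<Rightarrow> real) \<Rightarrow> complex \<Rightarrow> complex" where
  "g_fun p z = (if z = 0 then 0 else of_real (exp (p (norm z))))"

definition P1_fun ::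
    "(nat \<Rightarrow> complex) \<Rightarrow> (real \<Rightarrow> real) \<Rightarrow> (real \<Rightarrow> real) \<Rightarrow> complex \<Rightarrow> real" where
  "P1_fun c p q z =
     (if z = 0 then 0
      else exp (p (norm z) + Re (\<Sum>n. c (Suc n) / (\<i> * of_nat (Suc n)) * z ^ Suc n)
                - ln \<bar>cos (R_fun c q z)\<bar>))"

definition P_fun ::
    "(nat \<Rightarrow> complex) \<Rightarrow> real \<Rightarrow> (real \<Rightarrow> real) \<Rightarrow> (real \<Rightarrow> real) \<Rightarrow> complex \<Rightarrow> real" where
  "P_fun c \<alpha> p q z =
     (if \<alpha> \<noteq> 0 then 1 / \<alpha> * ln (1 + \<alpha> * P1_fun c p q z) else P1_fun c p q z)"

definition f_fun :: "(nat \<Rightarrow> complex) \<Rightarrow> real \<Rightarrow> (real \<Rightarrow> real) \<Rightarrow> complex \<Rightarrow> real \<Rightarrow> real" where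
  "f_fun c \<alpha> q z t =
     (if \<alpha> \<noteq> 0 then - (1 / \<alpha>) * ln \<bar>cos (R_fun c q z + \<alpha> * t) / cos (R_fun c q z)\<bar>
      else tan (R_fun c q z) * t)"

text \<open>The defining function of \<open>M(a, \<alpha>, p, q)\<close>. Only its germ at the origin is used, where
  the arguments of the logarithms are positive and the cosines do not vanish.\<close>

definition M_rho ::
    "(nat \<Rightarrow> complex) \<Rightarrow> real \<Rightarrow> (real \<Rightarrow> real) \<Rightarrow> (real \<Rightarrow> real) \<Rightarrow> complex \<times> complex \<Rightarrow> real"
  where
  "M_rho c \<alpha> p q = (\<lambda>(z1, z2). Re z1 + P_fun c \<alpha> p q z2 + f_fun c \<alpha> q z2 (Im z1))"

definition L_fun :: "real \<Rightarrow> complex \<Rightarrow> complex" where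
  "L_fun \<alpha> z = (if \<alpha> \<noteq> 0 then 1 / of_real \<alpha> * (exp (of_real \<alpha> * z) - 1) else z)"

definition H_field :: "(complex \<Rightarrow> complex) \<Rightarrow> real \<Rightarrow> vector_field" where
  "H_field a \<alpha> = (\<lambda>(z1, z2). (L_fun \<alpha> z1 * a z2, \<i> * z2))"

end

theory Submission
  imports Defs
begin

text \<open>Let \<open>A(z) = \<Sum> a\<^sub>n z\<^sup>n / n\<close>, so that \<open>z A'(z) = a(z)\<close>, and \<open>w = (1 - exp(-\<alpha> z\<^sub>1)) / \<alpha>\<close> (\<open>w = z\<^sub>1\<close> if
  \<open>\<alpha> = 0\<close>). In the holomorphic coordinates \<open>u = exp(\<i> A(z\<^sub>2)) w\<close>, \<open>z = z\<^sub>2\<close> the hypersurface becomes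
  rotationally symmetric,
    \<open>Re (exp(-\<i> q(|z|)) u) + G(|z|) = 0\<close> with \<open>G = exp \<circ> p\<close>,
  and \<open>H\<close> becomes the rotation field \<open>\<i> z \<partial>/\<partial>z\<close>. The defining function \<open>\<rho>\<close> equals the left-hand side
  for \<open>z\<^sub>2 \<noteq> 0\<close> up to a positive continuous factor and a logarithmic rescaling that fixes \<open>0\<close>
  (lemma \<open>M_rho_eq_log_scale\<close>), so at these points of \<open>\<rho> = 0\<close> both functions have the same tangent
  vectors (lemma \<open>tangency_iff\<close>). That \<open>H\<close> is tangent is then an identity; on \<open>z\<^sub>2 = 0\<close> it vanishes.

  Conversely, let \<open>k\<^sub>1 \<partial>/\<partial>u + h\<^sub>2 \<partial>/\<partial>z\<close> be tangent and vanish at \<open>0\<close>. Subtracting a real multiple of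
  the rotation field makes \<open>\<partial>h\<^sub>2/\<partial>z\<close> real at \<open>0\<close>; let \<open>k\<^sub>2\<close> be the new second component. At the points
  \<open>u = (-1 + \<i> \<tau>) G(r) exp(\<i> q(r))\<close>, \<open>z = r exp(\<i> \<theta>)\<close> of the hypersurface the tangency condition reads
    \<open>Re (exp(-\<i> q) k\<^sub>1) + (\<tau> G q' + G') Re (exp(-\<i> \<theta>) k\<^sub>2) = 0\<close>.
  Since \<open>G\<close> is smaller than every power of \<open>r\<close>, as \<open>r \<rightarrow> 0\<close> the two components are governed by the
  lexicographically leading terms \<open>b u\<^sup>k z\<^sup>n\<close> and \<open>d u\<^sup>m z\<^sup>j\<close> (lemma \<open>sep_holo_leading_term\<close>).
  If only \<open>k\<^sub>1\<close> is non-zero, its leading term contradicts the equation; if only \<open>k\<^sub>2\<close> is, then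
  \<open>\<tau> q' + G'/G = 0\<close> near \<open>0\<close> for some \<open>\<tau>\<close>. If both are non-zero, choose a direction \<open>(\<tau>, \<theta>)\<close> in
  which both leading terms contribute; then \<open>\<tau> q' + G'/G\<close> is comparable to
  \<open>G\<^sup>k r\<^sup>n / (G\<^sup>m\<^sup>+\<^sup>1 r\<^sup>j)\<close>. If \<open>k \<le> m\<close>, this contradicts flatness of \<open>G\<close> and \<open>G'\<close>. If \<open>k > m + 1\<close>, or
  \<open>k = m + 1\<close> and \<open>j \<le> n + 1\<close>, it gives \<open>G'/G = O(1/r)\<close>, as does \<open>\<tau> q' + G'/G = 0\<close>, and this is
  impossible for a flat positive \<open>G\<close> (lemma \<open>log_derivative_unbounded\<close>). If \<open>k = m + 1\<close> and
  \<open>j \<ge> n + 2\<close>, there is a direction in which only the first leading term contributes, and this is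
  incompatible with the same asymptotics. Hence \<open>k\<^sub>1 = k\<^sub>2 = 0\<close> (lemma \<open>tangency_rigidity\<close>).\<close>

section \<open>Leading terms of holomorphic functions of two variables\<close>

text \<open>Bounded and holomorphic in each variable separately on a bidisc of radius \<open>\<rho>\<close>; no joint regularity
  is needed below.\<close>

definition sep_holo :: "real \<Rightarrow> (complex \<Rightarrow> complex \<Rightarrow> complex) \<Rightarrow> bool" where
  "sep_holo \<rho> h \<longleftrightarrow>
     (\<forall>z\<in>ball 0 \<rho>. (\<lambda>u. h u z) holomorphic_on ball 0 \<rho>) \<and>
     (\<forall>u\<in>ball 0 \<rho>. h u holomorphic_on ball 0 \<rho>) \<and>
     (\<exists>M. \<forall>u\<in>ball 0 \<rho>. \<forall>z\<in>ball 0 \<rho>. norm (h u z) \<le> M)"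

lemma bounded_Taylor_remainder:
  fixes f :: "complex \<Rightarrow> complex"
  assumes hol: "f holomorphic_on ball 0 \<rho>" and \<rho>: "\<rho> > 0"
    and M: "\<And>u. u \<in> ball 0 \<rho> \<Longrightarrow> norm (f u) \<le> M"
    and van: "\<And>j. j < k \<Longrightarrow> (deriv ^^ j) f 0 = 0"
    and u: "norm u < \<rho> / 2"
  shows "norm (f u - u ^ k * ((deriv ^^ k) f 0 / fact k))
           \<le> fact (Suc k) * M / (\<rho> / 3) ^ Suc k * norm u ^ Suc k"
proof -
  have sub: "cball x (\<rho> / 3) \<subseteq> ball 0 \<rho>" if "x \<in> ball (0::complex) (\<rho> / 2)" for x
  proof
    fix y assume "y \<in> cball x (\<rho> / 3)"
    then have "norm y \<le> norm x + \<rho> / 3"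
      by (metis add.commute dist_norm mem_cball norm_minus_commute norm_triangle_sub order_trans
          add_le_cancel_left)
    then show "y \<in> ball 0 \<rho>" using that \<rho> by simp
  qed
  have d: "((deriv ^^ i) f has_field_derivative (deriv ^^ Suc i) f x) (at x within ball 0 (\<rho>/2))"
    if "x \<in> ball 0 (\<rho> / 2)" for i x
  proof -
    have "(deriv ^^ i) f holomorphic_on ball 0 \<rho>"
      by (intro holomorphic_higher_deriv hol) auto
    moreover have "x \<in> ball 0 \<rho>" using that \<rho> by auto
    ultimately have "((deriv ^^ i) f has_field_derivative deriv ((deriv ^^ i) f) x) (at x)"
      using holomorphic_derivI open_ball by blast
    then show ?thesis using has_field_derivative_at_within by auto
  qed
  have B: "norm ((deriv ^^ Suc k) f x) \<le> fact (Suc k) * M / (\<rho> / 3) ^ Suc k"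
    if "x \<in> ball 0 (\<rho> / 2)" for x
  proof (rule Cauchy_inequality)
    show "f holomorphic_on ball x (\<rho> / 3)"
      using hol sub[OF that] ball_subset_cball holomorphic_on_subset by blast
    show "continuous_on (cball x (\<rho> / 3)) f"
      using hol sub[OF that] holomorphic_on_imp_continuous_on continuous_on_subset by blast
    show "\<rho> / 3 > 0" using \<rho> by simp
    show "norm (f y) \<le> M" if "norm (x - y) = \<rho> / 3" for y
      using M sub[OF \<open>x \<in> ball 0 (\<rho> / 2)\<close>] that by (auto simp: dist_norm)
  qed
  have "norm ((deriv ^^ 0) f u - (\<Sum>i\<le>k. (deriv ^^ i) f 0 * (u - 0) ^ i / fact i))
          \<le> fact (Suc k) * M / (\<rho> / 3) ^ Suc k * norm (u - 0) ^ Suc k / fact k"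
    by (rule complex_Taylor[where S = "ball 0 (\<rho>/2)"]) (use d B u \<rho> in auto)
  moreover have "(\<Sum>i\<le>k. (deriv ^^ i) f 0 * (u - 0) ^ i / fact i)
                   = u ^ k * ((deriv ^^ k) f 0 / fact k)"
  proof -
    have "(\<Sum>i\<le>k. (deriv ^^ i) f 0 * (u - 0) ^ i / fact i)
            = (\<Sum>i\<in>{k}. (deriv ^^ i) f 0 * (u - 0) ^ i / fact i)"
      by (rule sum.mono_neutral_right) (auto simp: van)
    then show ?thesis by simp
  qed
  moreover have "fact (Suc k) * M / (\<rho> / 3) ^ Suc k * norm (u - 0) ^ Suc k / fact k
      \<le> fact (Suc k) * M / (\<rho> / 3) ^ Suc k * norm u ^ Suc k"
  proof -
    have "norm (f 0) \<le> M" using M[of 0] \<rho> by simp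
    then have "0 \<le> M" using norm_ge_zero order_trans by blast
    then have "0 \<le> fact (Suc k) * M / (\<rho> / 3) ^ Suc k * norm u ^ Suc k"
      using \<rho> by (intro mult_nonneg_nonneg divide_nonneg_nonneg zero_le_power) auto
    moreover have "(1::real) \<le> fact k" by (rule fact_ge_1)
    ultimately show ?thesis
      using divide_left_mono[of 1 "fact k" "fact (Suc k) * M / (\<rho> / 3) ^ Suc k * norm u ^ Suc k"]
      by simp
  qed
  ultimately show ?thesis by simp
qed

text \<open>The first non-vanishing Taylor coefficient of \<open>h\<close> with respect to \<open>u\<close> is holomorphic in \<open>z\<close>; splitting
  off its zero at the origin gives the leading term \<open>u\<^sup>k z\<^sup>n \<phi> 0\<close> for the order in which \<open>u\<close> is
  infinitely smaller than \<open>z\<close>.\<close>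

lemma sep_holo_leading_term:
  assumes h: "sep_holo \<rho> h" and \<rho>: "\<rho> > 0"
    and nz: "u0 \<in> ball 0 \<rho>" "z0 \<in> ball 0 \<rho>" "h u0 z0 \<noteq> 0"
  obtains k n :: nat and \<phi> C \<delta> where "\<delta> > 0" "\<phi> holomorphic_on ball 0 \<delta>" "\<phi> 0 \<noteq> 0"
    "\<And>u z. norm u < \<delta> \<Longrightarrow> norm z < \<delta> \<Longrightarrow>
       norm (h u z - u ^ k * (z ^ n * \<phi> z)) \<le> C * norm u ^ Suc k"
proof -
  obtain M where M: "\<And>u z. u \<in> ball 0 \<rho> \<Longrightarrow> z \<in> ball 0 \<rho> \<Longrightarrow> norm (h u z) \<le> M"
    using h unfolding sep_holo_def by blast
  define T where "T j z = (deriv ^^ j) (\<lambda>u. h u z) 0 / fact j" for j z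
  have "\<exists>j. \<exists>z\<in>ball 0 \<rho>. T j z \<noteq> 0"
  proof (rule ccontr)
    assume "\<not> ?thesis"
    then have "(deriv ^^ j) (\<lambda>u. h u z0) 0 = 0" for j
      using nz(2) unfolding T_def by (simp add: divide_eq_0_iff)
    moreover have "(\<lambda>u. h u z0) holomorphic_on ball 0 \<rho>"
      using h nz(2) unfolding sep_holo_def by blast
    ultimately have "h u0 z0 = 0"
      using holomorphic_fun_eq_0_on_ball[of "\<lambda>u. h u z0" 0 \<rho> u0] nz(1) by blast
    then show False using nz(3) by simp
  qed
  define k where "k = (LEAST j. \<exists>z\<in>ball 0 \<rho>. T j z \<noteq> 0)"
  have k: "\<exists>z\<in>ball 0 \<rho>. T k z \<noteq> 0"
    unfolding k_def by (rule LeastI_ex) fact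
  have less_k: "T j z = 0" if "j < k" "z \<in> ball 0 \<rho>" for j z
    using not_less_Least[of j "\<lambda>j. \<exists>z\<in>ball 0 \<rho>. T j z \<noteq> 0"] that unfolding k_def by blast
  define C where "C = fact (Suc k) * M / (\<rho> / 3) ^ Suc k"
  have rem: "norm (h u z - u ^ k * T k z) \<le> C * norm u ^ Suc k"
    if "norm u < \<rho> / 2" "z \<in> ball 0 \<rho>" for u z
    unfolding C_def T_def
  proof (rule bounded_Taylor_remainder[OF _ \<rho>])
    show "(\<lambda>u. h u z) holomorphic_on ball 0 \<rho>" using h that unfolding sep_holo_def by blast
    show "(deriv ^^ j) (\<lambda>u. h u z) 0 = 0" if "j < k" for j
      using less_k[OF that \<open>z \<in> ball 0 \<rho>\<close>] unfolding T_def by simp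
  qed (use M that in auto)
  \<comment> \<open>As all earlier coefficients vanish, \<open>T k\<close> is the uniform limit of \<open>h v z / v ^ k\<close> as \<open>v \<rightarrow> 0\<close>.\<close>
  have hol: "T k holomorphic_on ball 0 \<rho>"
  proof (rule holomorphic_uniform_sequence)
    define v :: "nat \<Rightarrow> complex" where "v i = of_real (\<rho> / (3 * real (Suc i)))" for i
    have vn: "norm (v i) = \<rho> / 3 / real (Suc i)" for i
      using \<rho> unfolding v_def norm_of_real by simp
    have v0: "v i \<noteq> 0" for i using vn[of i] \<rho> by auto
    have v1: "norm (v i) < \<rho> / 2" for i
    proof -
      have "\<rho> / 3 / real (Suc i) \<le> \<rho> / 3 / 1" using \<rho> by (intro divide_left_mono) auto
      then show ?thesis using \<rho> unfolding vn by linarith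
    qed
    show "(\<lambda>z. h (v i) z / v i ^ k) holomorphic_on ball 0 \<rho>" for i
    proof -
      have "v i \<in> ball 0 \<rho>" using v1[of i] \<rho> by simp
      then have "h (v i) holomorphic_on ball 0 \<rho>" using h unfolding sep_holo_def by blast
      then show ?thesis by (intro holomorphic_intros) (use v0 in auto)
    qed
    fix x :: complex assume x: "x \<in> ball 0 \<rho>"
    obtain d where d: "d > 0" "cball x d \<subseteq> ball 0 \<rho>"
      using x open_contains_cball open_ball by blast
    have "uniform_limit (cball x d) (\<lambda>i z. h (v i) z / v i ^ k) (T k) sequentially"
    proof (rule uniform_limitI)
      fix e :: real assume e: "e > 0"
      have "(\<lambda>i. C * (\<rho> / 3 / real (Suc i))) \<longlonglongrightarrow> C * 0"
        by (intro tendsto_intros LIMSEQ_Suc lim_const_over_n)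
      then have "\<forall>\<^sub>F i in sequentially. C * (\<rho> / 3 / real (Suc i)) < e"
        using e order_tendstoD(2) by fastforce
      then show "\<forall>\<^sub>F i in sequentially. \<forall>z\<in>cball x d. dist (h (v i) z / v i ^ k) (T k z) < e"
      proof eventually_elim
        case (elim i)
        show ?case
        proof
          fix z assume "z \<in> cball x d"
          then have "norm (h (v i) z - v i ^ k * T k z) \<le> C * norm (v i) ^ Suc k"
            using d by (intro rem v1) blast
          moreover have "h (v i) z / v i ^ k - T k z = (h (v i) z - v i ^ k * T k z) / v i ^ k"
            using v0 by (simp add: field_simps)
          ultimately have "dist (h (v i) z / v i ^ k) (T k z)
                             \<le> C * norm (v i) ^ Suc k / norm (v i) ^ k"
            unfolding dist_norm by (simp only: norm_divide norm_power divide_right_mono norm_ge_zero zero_le_power)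
          also have "\<dots> = C * norm (v i)" using v0 by simp
          also have "\<dots> < e" using elim vn by simp
          finally show "dist (h (v i) z / v i ^ k) (T k z) < e" .
        qed
      qed
    qed
    then show "\<exists>d>0. cball x d \<subseteq> ball 0 \<rho> \<and>
        uniform_limit (cball x d) (\<lambda>i z. h (v i) z / v i ^ k) (T k) sequentially"
      using d by blast
  qed auto
  have "0 \<in> ball (0::complex) \<rho>" using \<rho> by simp
  from conjunct2[OF zorder_exist_zero[OF hol open_ball connected_ball this k]]
  obtain r where "r > 0 \<and> cball (0::complex) r \<subseteq> ball 0 \<rho> \<and> zor_poly (T k) 0 holomorphic_on cball 0 r \<and>
      (\<forall>w\<in>cball 0 r. T k w = zor_poly (T k) 0 w * (w - 0) ^ nat (zorder (T k) 0)
         \<and> zor_poly (T k) 0 w \<noteq> 0)" by (elim exE) (rule that, assumption)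
  then have r: "r > 0" "cball (0::complex) r \<subseteq> ball 0 \<rho>" "zor_poly (T k) 0 holomorphic_on cball 0 r"
    and fac: "\<And>w. w \<in> cball 0 r \<Longrightarrow>
        T k w = zor_poly (T k) 0 w * (w - 0) ^ nat (zorder (T k) 0) \<and> zor_poly (T k) 0 w \<noteq> 0"
    by simp_all
  show ?thesis
  proof (rule that[of "min r (\<rho> / 2)" "zor_poly (T k) 0" k "nat (zorder (T k) 0)" C])
    show "min r (\<rho> / 2) > 0" using r \<rho> by simp
    show "zor_poly (T k) 0 holomorphic_on ball 0 (min r (\<rho> / 2))"
      by (rule holomorphic_on_subset[OF r(3)]) auto
    show "zor_poly (T k) 0 0 \<noteq> 0" using fac[of 0] r by simp
    fix u z :: complex
    assume "norm u < min r (\<rho> / 2)" "norm z < min r (\<rho> / 2)"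
    moreover from this have "z \<in> cball 0 r" "z \<in> ball 0 \<rho>" using \<rho> by auto
    ultimately show "norm (h u z - u ^ k * (z ^ nat (zorder (T k) 0) * zor_poly (T k) 0 z))
        \<le> C * norm u ^ Suc k"
      using rem[of u z] fac[of z] by (simp add: mult.commute)
  qed
qed

section \<open>Directions in which monomials have non-zero real part\<close>

lemma Re_mult_cis_zeros_apart:
  assumes "b \<noteq> 0" "l \<noteq> 0 \<or> Re b \<noteq> 0" "s \<noteq> t" "\<bar>l * (t - s)\<bar> < pi"
  shows "Re (b * cis (l * s)) \<noteq> 0 \<or> Re (b * cis (l * t)) \<noteq> 0"
proof (cases "l = 0")
  case False
  define w where "w = b * cis (l * s)"
  have "w \<noteq> 0" using assms(1) unfolding w_def by simp
  have "b * cis (l * t) = w * cis (l * (t - s))"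
    unfolding w_def mult.assoc cis_mult by (simp add: algebra_simps)
  then have eq: "Re (b * cis (l * t)) = Re w * cos (l * (t - s)) - Im w * sin (l * (t - s))"
    by simp
  have "sin (l * (t - s)) \<noteq> 0"
    using assms(3,4) False sin_zero_pi_iff by auto
  then show ?thesis using \<open>w \<noteq> 0\<close> eq complex_eqI[of w 0] unfolding w_def[symmetric] by auto
qed (use assms in auto)

text \<open>Among three points that are close together, each of the two functions vanishes at most once.\<close>

lemma Re_mult_cis_common_nonzero:
  assumes "b \<noteq> 0" "l \<noteq> 0 \<or> Re b \<noteq> 0" and "d \<noteq> 0" "l' \<noteq> 0 \<or> Re d \<noteq> 0"
  obtains s where "0 \<le> s" "s < 1" "Re (b * cis (l * s)) \<noteq> 0" "Re (d * cis (l' * s)) \<noteq> 0"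
proof -
  define \<delta> where "\<delta> = 1 / (4 * (1 + \<bar>l\<bar> + \<bar>l'\<bar>))"
  have \<delta>: "\<delta> > 0" unfolding \<delta>_def by simp
  have \<delta>1: "(1 + \<bar>l\<bar> + \<bar>l'\<bar>) * \<delta> = 1 / 4" unfolding \<delta>_def by (simp add: field_simps)
  then have "\<delta> + \<bar>l\<bar> * \<delta> + \<bar>l'\<bar> * \<delta> = 1 / 4" by (simp add: algebra_simps)
  moreover have "\<bar>l\<bar> * \<delta> \<ge> 0" "\<bar>l'\<bar> * \<delta> \<ge> 0" using \<delta> by auto
  ultimately have small: "\<delta> \<le> 1 / 4" "\<bar>l\<bar> * \<delta> \<le> 1 / 4" "\<bar>l'\<bar> * \<delta> \<le> 1 / 4"
    using \<delta> by linarith+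
  have pi: "pi > 3" by (rule pi_gt3)
  have abs: "\<bar>x * (i * \<delta> - j * \<delta>)\<bar> < pi"
    if "\<bar>x\<bar> * \<delta> \<le> 1 / 4" "\<bar>i - j\<bar> \<le> 2" for x i j :: real
  proof -
    have "\<bar>x * (i * \<delta> - j * \<delta>)\<bar> = \<bar>i - j\<bar> * (\<bar>x\<bar> * \<delta>)"
      using \<delta> by (simp add: abs_mult left_diff_distrib[symmetric])
    also have "\<dots> \<le> 2 * (1 / 4)" using that \<delta> by (intro mult_mono) auto
    finally show ?thesis using pi by linarith
  qed
  have sep: "Re (b * cis (l * (i * \<delta>))) \<noteq> 0 \<or> Re (b * cis (l * (j * \<delta>))) \<noteq> 0"
    "Re (d * cis (l' * (i * \<delta>))) \<noteq> 0 \<or> Re (d * cis (l' * (j * \<delta>))) \<noteq> 0"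
    if "\<bar>j - i\<bar> \<le> 2" "i \<noteq> j" for i j
  proof -
    have ne: "i * \<delta> \<noteq> j * \<delta>" using that \<delta> by simp
    show "Re (b * cis (l * (i * \<delta>))) \<noteq> 0 \<or> Re (b * cis (l * (j * \<delta>))) \<noteq> 0"
      using assms(1,2) ne abs[OF small(2) that(1)] by (rule Re_mult_cis_zeros_apart)
    show "Re (d * cis (l' * (i * \<delta>))) \<noteq> 0 \<or> Re (d * cis (l' * (j * \<delta>))) \<noteq> 0"
      using assms(3,4) ne abs[OF small(3) that(1)] by (rule Re_mult_cis_zeros_apart)
  qed
  have "\<exists>i\<in>{0,1,2}. Re (b * cis (l * (i * \<delta>))) \<noteq> 0 \<and> Re (d * cis (l' * (i * \<delta>))) \<noteq> 0"
    using sep[of 1 0] sep[of 2 0] sep[of 2 1] by auto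
  then obtain i where "i \<in> {0,1,2}" "Re (b * cis (l * (i * \<delta>))) \<noteq> 0"
    "Re (d * cis (l' * (i * \<delta>))) \<noteq> 0" by blast
  then show ?thesis using that[of "i * \<delta>"] \<delta> small by auto
qed

text \<open>Directions \<open>\<tau> = - tan s\<close>, \<open>\<theta> = \<theta>\<^sub>0 + \<mu> s\<close>: then \<open>-1 + \<i> \<tau>\<close> is a real multiple of \<open>exp(\<i> s)\<close>, and
  up to a power of \<open>cos s\<close> the real part of a monomial oscillates in \<open>s\<close> with a single frequency.\<close>

lemma Re_mult_power_cis:
  assumes "cos s \<noteq> 0"
  shows "Re (b * Complex (-1) (- tan s) ^ k * cis (x * (\<theta>\<^sub>0 + \<mu> * s)))
       = Re (((-1) ^ k * b * cis (x * \<theta>\<^sub>0)) * cis ((real k + x * \<mu>) * s)) / cos s ^ k"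
proof -
  have "Complex (-1) (- tan s) = - cis s / of_real (cos s)"
    using assms by (simp add: complex_eq_iff tan_def)
  then have "Complex (-1) (- tan s) ^ k = (-1) ^ k * cis s ^ k / of_real (cos s ^ k)"
    by (simp add: power_divide power_minus[of "cis s / of_real (cos s)"])
  then have "Complex (-1) (- tan s) ^ k = (-1) ^ k * cis (real k * s) / of_real (cos s ^ k)"
    unfolding Complex.DeMoivre .
  moreover have "cis (real k * s) * cis (x * (\<theta>\<^sub>0 + \<mu> * s))
      = cis (x * \<theta>\<^sub>0) * cis ((real k + x * \<mu>) * s)"
    unfolding cis_mult by (simp add: algebra_simps)
  ultimately have "b * Complex (-1) (- tan s) ^ k * cis (x * (\<theta>\<^sub>0 + \<mu> * s))
      = ((-1) ^ k * b * cis (x * \<theta>\<^sub>0)) * cis ((real k + x * \<mu>) * s) / of_real (cos s ^ k)"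
    by (simp add: mult_ac)
  then show ?thesis using Re_divide_of_real by metis
qed

lemma direction_both_nonzero:
  assumes "b \<noteq> 0" "k \<noteq> 0 \<or> n \<noteq> 0" and "d \<noteq> 0" "m \<noteq> 0 \<or> j \<noteq> 1 \<or> Re d \<noteq> 0"
  obtains \<tau> \<theta> :: real where "Re (b * Complex (-1) \<tau> ^ k * cis (real n * \<theta>)) \<noteq> 0"
    "Re (d * Complex (-1) \<tau> ^ m * cis ((real j - 1) * \<theta>)) \<noteq> 0"
proof -
  \<comment> \<open>The slope \<open>\<mu> = 1/2\<close> makes both frequencies non-zero, except that the second one vanishes
    for \<open>m = 0\<close>, \<open>j = 1\<close>.\<close>
  have 1: "real k + real n * (1 / 2) \<noteq> 0" using assms(2) by (auto simp: add_nonneg_eq_0_iff)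
  have 2: "real m + (real j - 1) * (1 / 2) \<noteq> 0 \<or> Re d \<noteq> 0 \<and> m = 0"
  proof (cases "2 * m + j = 1")
    case True
    then have "m = 0" "j = 1" by presburger+
    then show ?thesis using assms by auto
  next
    case False
    then have "real (2 * m + j) \<noteq> real 1" by (metis of_nat_eq_iff)
    then have "2 * real m + real j \<noteq> 1" by simp
    then have "real m + (real j - 1) * (1 / 2) \<noteq> 0" by argo
    then show ?thesis ..
  qed
  obtain s where s: "0 \<le> s" "s < 1" "Re (((-1) ^ k * b) * cis ((real k + real n * (1 / 2)) * s)) \<noteq> 0"
    "Re (((-1) ^ m * d) * cis ((real m + (real j - 1) * (1 / 2)) * s)) \<noteq> 0"
    using Re_mult_cis_common_nonzero[of "(-1) ^ k * b" "real k + real n * (1 / 2)" "(-1) ^ m * d"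
        "real m + (real j - 1) * (1 / 2)"] 1 2 assms(1,3) by auto
  have "cos s > 0" using s pi_gt3 by (intro cos_gt_zero_pi) linarith+
  then show ?thesis
    using that[of "- tan s" "0 + 1 / 2 * s"] s(3,4)
    by (simp add: Re_mult_power_cis[of s _ _ _ 0 "1/2", simplified])
qed

text \<open>The slope \<open>\<mu> = - m / (j - 1)\<close> keeps the argument of the second monomial constant, while that of the
  first one still varies.\<close>

lemma direction_one_zero:
  assumes "b \<noteq> 0" "n + 2 \<le> j"
  obtains \<tau> \<theta> :: real where "Re (b * Complex (-1) \<tau> ^ Suc m * cis (real n * \<theta>)) \<noteq> 0"
    "Re (d * Complex (-1) \<tau> ^ m * cis ((real j - 1) * \<theta>)) = 0"
proof -
  define x where "x = real j - 1"
  have x: "x \<ge> real n + 1" using assms(2) unfolding x_def by linarith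
  define \<theta>\<^sub>0 where "\<theta>\<^sub>0 = (pi / 2 - Arg ((-1) ^ m * d)) / x"
  define \<mu> where "\<mu> = - real m / x"
  have x0: "x \<noteq> 0" using x by linarith
  have D0: "real m + x * \<mu> = 0" "x * \<theta>\<^sub>0 = pi / 2 - Arg ((-1) ^ m * d)"
    using x0 unfolding \<mu>_def \<theta>\<^sub>0_def by auto
  have "real n * real m / x \<le> real m"
    using x mult_right_mono[of "real n" x "real m"] by (simp add: divide_le_eq mult.commute)
  then have B0: "real (Suc m) + real n * \<mu> \<noteq> 0" unfolding \<mu>_def by simp
  have "(-1) ^ m * d = of_real (norm ((-1) ^ m * d)) * cis (Arg ((-1) ^ m * d))"
    using rcis_cmod_Arg[of "(-1) ^ m * d"] unfolding rcis_def by simp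
  then have "(-1) ^ m * d * cis (x * \<theta>\<^sub>0) = of_real (norm ((-1) ^ m * d)) * cis (pi / 2)"
    unfolding D0 by (metis (no_types) add_diff_cancel_left' cis_mult diff_add_cancel mult.assoc
        add.commute)
  then have Re0: "Re ((-1) ^ m * d * cis (x * \<theta>\<^sub>0)) = 0" by (simp only: cis_pi_half) simp
  obtain s where s: "0 \<le> s" "s < 1"
    "Re (((-1) ^ Suc m * b * cis (real n * \<theta>\<^sub>0)) * cis ((real (Suc m) + real n * \<mu>) * s)) \<noteq> 0"
    using Re_mult_cis_common_nonzero[of "(-1) ^ Suc m * b * cis (real n * \<theta>\<^sub>0)"
        "real (Suc m) + real n * \<mu>" 1 1] B0 assms(1) by auto
  have c: "cos s > 0" using s pi_gt3 by (intro cos_gt_zero_pi) linarith+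
  show ?thesis
  proof (rule that[of "- tan s" "\<theta>\<^sub>0 + \<mu> * s"])
    show "Re (b * Complex (-1) (- tan s) ^ Suc m * cis (real n * (\<theta>\<^sub>0 + \<mu> * s))) \<noteq> 0"
      using s c by (subst Re_mult_power_cis) auto
    show "Re (d * Complex (-1) (- tan s) ^ m * cis ((real j - 1) * (\<theta>\<^sub>0 + \<mu> * s))) = 0"
      using c Re0 unfolding x_def[symmetric] by (subst Re_mult_power_cis) (simp_all only: D0, auto)
  qed
qed

section \<open>Rigidity of fields tangent to a flat rotational hypersurface\<close>

text \<open>The radial data of the hypersurface \<open>Re (exp(-\<i> q(|z|)) u) + G(|z|) = 0\<close>: a positive flat function \<open>G\<close>
  with flat derivative \<open>G'\<close>, and an angle \<open>q\<close> with bounded derivative \<open>q'\<close>. Boundedness of \<open>q'\<close> and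
  \<open>q \<rightarrow> 0\<close> suffice.\<close>

locale flat_profile =
  fixes G G' q q' :: "real \<Rightarrow> real" and \<epsilon> Q :: real
  assumes eps_pos: "\<epsilon> > 0"
    and G_pos: "\<And>r. 0 < r \<Longrightarrow> r < \<epsilon> \<Longrightarrow> G r > 0"
    and G_deriv: "\<And>r. 0 < r \<Longrightarrow> r < \<epsilon> \<Longrightarrow> (G has_real_derivative G' r) (at r)"
    and q'_bound: "\<And>r. 0 < r \<Longrightarrow> r < \<epsilon> \<Longrightarrow> \<bar>q' r\<bar> \<le> Q"
    and q_tendsto: "(q \<longlongrightarrow> 0) (at_right 0)"
    and G_flat: "\<And>N::nat. \<exists>C. \<forall>\<^sub>F r in at_right 0. G r \<le> C * r ^ N"
    and G'_flat: "\<And>N::nat. \<exists>C. \<forall>\<^sub>F r in at_right 0. \<bar>G' r\<bar> \<le> C * r ^ N"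
begin

lemma near0: "\<forall>\<^sub>F r in at_right 0. 0 < r \<and> r < \<epsilon> \<and> r < 1"
  using eps_pos unfolding eventually_at_right_field by (intro exI[of _ "min \<epsilon> 1"]) simp

lemma flat_tendsto:
  assumes "\<And>N::nat. \<exists>C. \<forall>\<^sub>F r in at_right 0. \<bar>f r\<bar> \<le> C * r ^ N"
  shows "((\<lambda>r::real. f r / r ^ N :: real) \<longlongrightarrow> 0) (at_right 0)"
proof -
  obtain C where C: "\<forall>\<^sub>F r in at_right 0. \<bar>f r\<bar> \<le> C * r ^ Suc N" using assms by blast
  have "\<forall>\<^sub>F r in at_right 0. norm (f r / r ^ N) \<le> C * r"
    using C near0
  proof eventually_elim
    case (elim r)
    then have "\<bar>f r\<bar> / r ^ N \<le> C * r ^ Suc N / r ^ N" by (intro divide_right_mono) auto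
    then show ?case using elim by (simp add: abs_divide)
  qed
  moreover have "((\<lambda>r. C * r) \<longlongrightarrow> 0) (at_right 0)"
    by (rule tendsto_eq_intros refl | simp)+
  ultimately show ?thesis by (rule Lim_null_comparison)
qed

lemma G_over_power: "((\<lambda>r. G r / r ^ N) \<longlongrightarrow> 0) (at_right 0)"
proof (rule flat_tendsto)
  fix N
  obtain C where "\<forall>\<^sub>F r in at_right 0. G r \<le> C * r ^ N" using G_flat by blast
  then have "\<forall>\<^sub>F r in at_right 0. \<bar>G r\<bar> \<le> C * r ^ N"
    using near0 by eventually_elim (use G_pos in \<open>auto simp: abs_of_pos\<close>)
  then show "\<exists>C. \<forall>\<^sub>F r in at_right 0. \<bar>G r\<bar> \<le> C * r ^ N" by blast
qed

lemma G_tendsto: "(G \<longlongrightarrow> 0) (at_right 0)"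
  using G_over_power[of 0] by simp

lemma G'_over_power: "((\<lambda>r. G' r / r ^ N) \<longlongrightarrow> 0) (at_right 0)"
  by (rule flat_tendsto) (rule G'_flat)

text \<open>A bound \<open>G'/G \<le> N / r\<close> would make \<open>G / r\<^sup>N\<close> nonincreasing, hence bounded below near \<open>0\<close>.\<close>

lemma log_derivative_unbounded:
  "\<not> (\<forall>\<^sub>F r in at_right 0. \<bar>G' r\<bar> \<le> C * (G r / r))"
proof
  assume "\<forall>\<^sub>F r in at_right 0. \<bar>G' r\<bar> \<le> C * (G r / r)"
  then have "\<forall>\<^sub>F r in at_right 0. 0 < r \<and> r < \<epsilon> \<and> G' r \<le> C * (G r / r)"
    using near0 by eventually_elim auto
  then obtain r0 where r0: "r0 > 0"
    and le: "\<And>r. 0 < r \<Longrightarrow> r < r0 \<Longrightarrow> r < \<epsilon> \<and> G' r \<le> C * (G r / r)"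
    unfolding eventually_at_right_field by auto
  obtain N where N: "C \<le> real N" using real_arch_simple by blast
  define \<phi> where "\<phi> r = G r / r ^ N" for r
  define r1 where "r1 = r0 / 2"
  have r1: "0 < r1" "r1 < r0" using r0 unfolding r1_def by auto
  have mono: "\<phi> r1 \<le> \<phi> r" if "0 < r" "r \<le> r1" for r
  proof (rule DERIV_nonpos_imp_nonincreasing[OF that(2)])
    fix x assume x: "r \<le> x" "x \<le> r1"
    then have x': "0 < x" "x < r0" "x < \<epsilon>" using that r1 le[of x] by auto
    have "(\<phi> has_real_derivative (G' x * x ^ N - G x * (real N * x ^ (N - 1))) / (x ^ N * x ^ N))
            (at x)"
      unfolding \<phi>_def using x' G_deriv
      by (auto intro!: derivative_eq_intros simp: power2_eq_square)
    moreover have "G' x * x ^ N - G x * (real N * x ^ (N - 1)) \<le> 0"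
    proof -
      have p: "G x * (real N * x ^ (N - 1)) = real N * (G x / x) * x ^ N"
        using x' by (cases N) (auto simp: field_simps)
      have "G' x \<le> C * (G x / x)" using le x' by blast
      also have "\<dots> \<le> real N * (G x / x)"
        using N G_pos x' by (intro mult_right_mono) (auto simp: less_imp_le)
      finally have "G' x * x ^ N \<le> real N * (G x / x) * x ^ N"
        using x' by (intro mult_right_mono) auto
      then show ?thesis unfolding p by simp
    qed
    moreover have "0 \<le> x ^ N * x ^ N" by simp
    ultimately show "\<exists>y. (\<phi> has_real_derivative y) (at x) \<and> y \<le> 0"
      using divide_nonpos_nonneg by blast
  qed
  have pos: "\<phi> r1 > 0" using G_pos r1 le[of r1] unfolding \<phi>_def by simp
  have "\<forall>\<^sub>F r in at_right 0. \<phi> r < \<phi> r1"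
    using order_tendstoD(2)[OF G_over_power[of N] pos] unfolding \<phi>_def .
  then have "\<forall>\<^sub>F r in at_right 0. \<phi> r < \<phi> r1 \<and> 0 < r \<and> r < r1"
    using r1 by (auto simp: eventually_conj_iff eventually_at_right_field)
  then have "\<forall>\<^sub>F r in at_right (0::real). False"
    by eventually_elim (use mono in fastforce)
  then show False by simp
qed

text \<open>The coordinate \<open>u\<close> of a point of the hypersurface over \<open>|z| = r\<close>, with \<open>Im (exp(-\<i> q) u)\<close> scaled to be of
  the size \<open>G r\<close> of its real part.\<close>

definition sample :: "real \<Rightarrow> real \<Rightarrow> complex" where
  "sample \<tau> r = Complex (-1) \<tau> * of_real (G r) * cis (q r)"

lemma sample_tendsto: "(sample \<tau> \<longlongrightarrow> 0) (at_right 0)"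
proof -
  have "((\<lambda>r. Complex (-1) \<tau> * of_real (G r) * cis (q r)) \<longlongrightarrow> Complex (-1) \<tau> * of_real 0 * cis 0)
          (at_right 0)"
    by (intro tendsto_intros G_tendsto q_tendsto)
  then show ?thesis unfolding sample_def by simp
qed

text \<open>Along these points a function is asymptotic to its leading term, because \<open>u\<close> is flat in \<open>r\<close>. The two
  low-order cases of the leading coefficient \<open>b\<close> are the ones that normalization at the origin excludes
  or makes real.\<close>

lemma sep_holo_sample_limit:
  assumes h: "sep_holo \<rho> h" and \<rho>: "\<rho> > 0"
    and nz: "\<exists>u\<in>ball 0 \<rho>. \<exists>z\<in>ball 0 \<rho>. h u z \<noteq> 0"
  obtains b k n where "b \<noteq> 0" "k = 0 \<Longrightarrow> n = 0 \<Longrightarrow> b = h 0 0" "k = 0 \<Longrightarrow> n = 1 \<Longrightarrow> b = deriv (h 0) 0"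
    "\<And>\<tau> \<theta>. ((\<lambda>r. h (sample \<tau> r) (of_real r * cis \<theta>) / of_real (G r ^ k * r ^ n))
        \<longlongrightarrow> b * Complex (-1) \<tau> ^ k * cis (real n * \<theta>)) (at_right 0)"
proof -
  obtain u0 z0 where "u0 \<in> ball 0 \<rho>" "z0 \<in> ball 0 \<rho>" "h u0 z0 \<noteq> 0" using nz by blast
  from sep_holo_leading_term[OF h \<rho> this] obtain k n :: nat and \<phi> C \<delta> where \<delta>: "\<delta> > 0"
    and hol: "\<phi> holomorphic_on ball 0 \<delta>" and \<phi>0: "\<phi> 0 \<noteq> 0"
    and lead: "\<And>u z. norm u < \<delta> \<Longrightarrow> norm z < \<delta> \<Longrightarrow>
       norm (h u z - u ^ k * (z ^ n * \<phi> z)) \<le> C * norm u ^ Suc k" by metis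
  have at0: "h 0 z = 0 ^ k * (z ^ n * \<phi> z)" if "norm z < \<delta>" for z
    using lead[of 0 z] that \<delta> by simp
  show ?thesis
  proof (rule that[of "\<phi> 0" k n])
    show "\<phi> 0 \<noteq> 0" by (rule \<phi>0)
    show "\<phi> 0 = h 0 0" if "k = 0" "n = 0" using at0[of 0] \<delta> that by simp
    show "\<phi> 0 = deriv (h 0) 0" if "k = 0" "n = 1"
    proof -
      have "(\<phi> has_field_derivative deriv \<phi> 0) (at 0)"
        using hol \<delta> by (intro holomorphic_derivI[of _ "ball 0 \<delta>"]) auto
      then have "((\<lambda>z. z * \<phi> z) has_field_derivative \<phi> 0) (at 0)"
        by (auto intro!: derivative_eq_intros)
      moreover have ev0: "\<forall>\<^sub>F z in nhds 0. z * \<phi> z = h 0 z"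
        using eventually_nhds_in_open[of "ball 0 \<delta>" "0::complex"] \<delta>
        by (auto elim!: eventually_mono simp: at0 that)
      ultimately have "(h 0 has_field_derivative \<phi> 0) (at 0)"
        using DERIV_cong_ev[OF refl ev0 refl] by simp
      then show ?thesis by (simp add: DERIV_imp_deriv)
    qed
    fix \<tau> \<theta> :: real
    define \<sigma> where "\<sigma> = Complex (-1) \<tau>"
    define u where "u = sample \<tau>"
    define z where "z r = of_real r * cis \<theta>" for r
    have u0: "(u \<longlongrightarrow> 0) (at_right 0)" unfolding u_def by (rule sample_tendsto)
    have "(z \<longlongrightarrow> of_real 0 * cis \<theta>) (at_right 0)" unfolding z_def by (intro tendsto_intros)
    then have z0: "(z \<longlongrightarrow> 0) (at_right 0)" by simp
    have ev: "\<forall>\<^sub>F r in at_right 0. norm (u r) < \<delta>" "\<forall>\<^sub>F r in at_right 0. norm (z r) < \<delta>"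
      using tendstoD[OF u0 \<delta>] tendstoD[OF z0 \<delta>] by simp_all
    have "isCont \<phi> 0"
      using hol \<delta> by (metis centre_in_ball continuous_on_eq_continuous_at
          holomorphic_on_imp_continuous_on open_ball)
    then have \<phi>z: "((\<lambda>r. \<phi> (z r)) \<longlongrightarrow> \<phi> 0) (at_right 0)"
      using isCont_tendsto_compose z0 by blast
    have main: "((\<lambda>r. \<sigma> ^ k * cis (q r) ^ k * cis \<theta> ^ n * \<phi> (z r))
        \<longlongrightarrow> \<sigma> ^ k * cis 0 ^ k * cis \<theta> ^ n * \<phi> 0) (at_right 0)"
      by (intro tendsto_intros q_tendsto \<phi>z)
    have "((\<lambda>r. C * norm \<sigma> ^ Suc k * (G r / r ^ n)) \<longlongrightarrow> C * norm \<sigma> ^ Suc k * 0) (at_right 0)"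
      by (intro tendsto_intros G_over_power)
    then have err: "((\<lambda>r. C * norm \<sigma> ^ Suc k * (G r / r ^ n)) \<longlongrightarrow> 0) (at_right 0)" by simp
    have "((\<lambda>r. (h (u r) (z r) - u r ^ k * (z r ^ n * \<phi> (z r))) / of_real (G r ^ k * r ^ n))
        \<longlongrightarrow> 0) (at_right 0)"
    proof (rule Lim_null_comparison[OF _ err])
      show "\<forall>\<^sub>F r in at_right 0. norm ((h (u r) (z r) - u r ^ k * (z r ^ n * \<phi> (z r)))
              / of_real (G r ^ k * r ^ n)) \<le> C * norm \<sigma> ^ Suc k * (G r / r ^ n)"
        using ev near0
      proof eventually_elim
        case (elim r)
        have G: "G r > 0" using G_pos elim by blast
        have "norm (u r) = norm \<sigma> * G r"
          using G unfolding u_def sample_def \<sigma>_def by (simp add: norm_mult)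
        then have "norm (h (u r) (z r) - u r ^ k * (z r ^ n * \<phi> (z r)))
                     \<le> C * (norm \<sigma> * G r) ^ Suc k" using lead elim by metis
        then have "norm (h (u r) (z r) - u r ^ k * (z r ^ n * \<phi> (z r))) / (G r ^ k * r ^ n)
                     \<le> C * (norm \<sigma> * G r) ^ Suc k / (G r ^ k * r ^ n)"
          using G elim by (intro divide_right_mono) auto
        also have "\<dots> = C * norm \<sigma> ^ Suc k * (G r / r ^ n)"
          using G by (simp add: power_mult_distrib)
        finally show ?case using G elim unfolding norm_divide norm_of_real by simp
      qed
    qed
    from tendsto_add[OF this main]
    have "((\<lambda>r. (h (u r) (z r) - u r ^ k * (z r ^ n * \<phi> (z r))) / of_real (G r ^ k * r ^ n)
        + \<sigma> ^ k * cis (q r) ^ k * cis \<theta> ^ n * \<phi> (z r)) \<longlongrightarrow> \<phi> 0 * \<sigma> ^ k * cis (real n * \<theta>)) (at_right 0)"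
      unfolding Complex.DeMoivre[symmetric] by (simp add: mult_ac)
    moreover have "\<forall>\<^sub>F r in at_right 0. (h (u r) (z r) - u r ^ k * (z r ^ n * \<phi> (z r)))
        / of_real (G r ^ k * r ^ n) + \<sigma> ^ k * cis (q r) ^ k * cis \<theta> ^ n * \<phi> (z r)
        = h (u r) (z r) / of_real (G r ^ k * r ^ n)"
      using near0
    proof eventually_elim
      case (elim r)
      have "G r > 0" using G_pos elim by blast
      then have "u r ^ k * (z r ^ n * \<phi> (z r)) / of_real (G r ^ k * r ^ n)
          = \<sigma> ^ k * cis (q r) ^ k * cis \<theta> ^ n * \<phi> (z r)"
        using elim unfolding u_def sample_def \<sigma>_def[symmetric] z_def
        by (simp add: power_mult_distrib)
      then show ?case by (simp add: diff_divide_distrib)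
    qed
    ultimately show "((\<lambda>r. h (sample \<tau> r) (of_real r * cis \<theta>) / of_real (G r ^ k * r ^ n))
        \<longlongrightarrow> \<phi> 0 * Complex (-1) \<tau> ^ k * cis (real n * \<theta>)) (at_right 0)"
      unfolding u_def z_def \<sigma>_def by (rule Lim_transform_eventually)
  qed
qed

lemma eventually_G_small: "\<forall>\<^sub>F r in at_right 0. 0 < G r \<and> G r < 1"
proof -
  have "\<forall>\<^sub>F r in at_right 0. G r < 1" using order_tendstoD(2)[OF G_tendsto, of 1] by simp
  then show ?thesis using near0 by eventually_elim (use G_pos in blast)
qed

lemma log_derivative_bound_absurd:
  assumes "\<forall>\<^sub>F r in at_right 0. \<bar>\<tau> * q' r + G' r / G r\<bar> \<le> K / r"
  shows False
proof -
  have "\<forall>\<^sub>F r in at_right 0. \<bar>G' r\<bar> \<le> (K + \<bar>\<tau>\<bar> * Q) * (G r / r)"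
    using assms near0
  proof eventually_elim
    case (elim r)
    have G: "G r > 0" using G_pos elim by blast
    have "\<bar>\<tau> * q' r\<bar> \<le> \<bar>\<tau>\<bar> * Q" using q'_bound elim by (simp add: abs_mult mult_left_mono)
    also have "\<dots> \<le> \<bar>\<tau>\<bar> * Q / r"
    proof -
      have "Q \<ge> 0" using q'_bound[of r] elim by linarith
      then have "\<bar>\<tau>\<bar> * Q * r \<le> \<bar>\<tau>\<bar> * Q * 1" using elim by (intro mult_left_mono) auto
      then show ?thesis using elim by (simp add: le_divide_eq)
    qed
    finally have "\<bar>G' r / G r\<bar> \<le> K / r + \<bar>\<tau>\<bar> * Q / r" using elim by linarith
    also have "\<dots> = (K + \<bar>\<tau>\<bar> * Q) / r" by (simp add: add_divide_distrib)
    finally have "\<bar>G' r / G r\<bar> * G r \<le> (K + \<bar>\<tau>\<bar> * Q) / r * G r"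
      using G by (intro mult_right_mono) auto
    moreover have "\<bar>G' r / G r\<bar> * G r = \<bar>G' r\<bar>" using G by (simp add: abs_divide)
    ultimately show ?case by simp
  qed
  then show False using log_derivative_unbounded by blast
qed

text \<open>The condition \<open>tan\<close> says that the field with components \<open>k1\<close>, \<open>k2\<close> is tangent at the sample points. The
  condition on \<open>deriv (k2 0) 0\<close> excludes the rotation field, which is always tangent.\<close>

lemma tangency_rigidity:
  assumes \<rho>: "\<rho> > 0" and k1: "sep_holo \<rho> k1" and k2: "sep_holo \<rho> k2"
    and van: "k1 0 0 = 0" "k2 0 0 = 0" and Im0: "Im (deriv (k2 0) 0) = 0"
    and tan: "\<And>\<tau> \<theta>. \<forall>\<^sub>F r in at_right 0.
        Re (cis (- q r) * k1 (sample \<tau> r) (of_real r * cis \<theta>))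
        + (\<tau> * G r * q' r + G' r) * Re (cis (- \<theta>) * k2 (sample \<tau> r) (of_real r * cis \<theta>)) = 0"
  shows "\<forall>u\<in>ball 0 \<rho>. \<forall>z\<in>ball 0 \<rho>. k1 u z = 0 \<and> k2 u z = 0"
proof (rule ccontr)
  assume "\<not> ?thesis"
  then have nz: "(\<exists>u\<in>ball 0 \<rho>. \<exists>z\<in>ball 0 \<rho>. k1 u z \<noteq> 0) \<or> (\<exists>u\<in>ball 0 \<rho>. \<exists>z\<in>ball 0 \<rho>. k2 u z \<noteq> 0)"
    by blast
  define N1 where "N1 k n \<tau> \<theta> r
    = Re (cis (- q r) * (k1 (sample \<tau> r) (of_real r * cis \<theta>) / of_real (G r ^ k * r ^ n)))"
    for k n :: nat and \<tau> \<theta> r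
  define N2 where "N2 m j \<tau> \<theta> r
    = Re (cis (- \<theta>) * (k2 (sample \<tau> r) (of_real r * cis \<theta>) / of_real (G r ^ m * r ^ j)))"
    for m j :: nat and \<tau> \<theta> r
  define X where "X \<tau> r = \<tau> * q' r + G' r / G r" for \<tau> r
  have eqN: "\<forall>\<^sub>F r in at_right 0. N1 k n \<tau> \<theta> r * (G r ^ k * r ^ n)
      + X \<tau> r * (G r ^ Suc m * r ^ j) * N2 m j \<tau> \<theta> r = 0" for k n m j \<tau> \<theta>
    using tan[of \<tau> \<theta>] near0
  proof eventually_elim
    case (elim r)
    have G: "G r > 0" using G_pos elim by blast
    have "N1 k n \<tau> \<theta> r * (G r ^ k * r ^ n)
        = Re (cis (- q r) * k1 (sample \<tau> r) (of_real r * cis \<theta>))"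
      unfolding N1_def times_divide_eq_right Re_divide_of_real using G elim by simp
    moreover have "N2 m j \<tau> \<theta> r * (G r ^ m * r ^ j)
        = Re (cis (- \<theta>) * k2 (sample \<tau> r) (of_real r * cis \<theta>))"
      unfolding N2_def times_divide_eq_right Re_divide_of_real using G elim by simp
    moreover have "X \<tau> r * G r = \<tau> * G r * q' r + G' r"
      unfolding X_def using G by (simp add: field_simps)
    moreover have "X \<tau> r * (G r ^ Suc m * r ^ j) * N2 m j \<tau> \<theta> r
        = (X \<tau> r * G r) * (N2 m j \<tau> \<theta> r * (G r ^ m * r ^ j))" by simp
    ultimately show ?case using elim by simp
  qed
  have lim1: "(N1 k n \<tau> \<theta> \<longlongrightarrow> Re (b * Complex (-1) \<tau> ^ k * cis (real n * \<theta>))) (at_right 0)"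
    if "((\<lambda>r. k1 (sample \<tau> r) (of_real r * cis \<theta>) / of_real (G r ^ k * r ^ n))
        \<longlongrightarrow> b * Complex (-1) \<tau> ^ k * cis (real n * \<theta>)) (at_right 0)" for b k n \<tau> \<theta>
  proof -
    have "((\<lambda>r. Re (cis (- q r) * (k1 (sample \<tau> r) (of_real r * cis \<theta>) / of_real (G r ^ k * r ^ n))))
        \<longlongrightarrow> Re (cis (- 0) * (b * Complex (-1) \<tau> ^ k * cis (real n * \<theta>)))) (at_right 0)"
      by (intro tendsto_intros q_tendsto that)
    then show ?thesis unfolding N1_def by simp
  qed
  have lim2: "(N2 m j \<tau> \<theta> \<longlongrightarrow> Re (d * Complex (-1) \<tau> ^ m * cis ((real j - 1) * \<theta>))) (at_right 0)"
    if "((\<lambda>r. k2 (sample \<tau> r) (of_real r * cis \<theta>) / of_real (G r ^ m * r ^ j))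
        \<longlongrightarrow> d * Complex (-1) \<tau> ^ m * cis (real j * \<theta>)) (at_right 0)" for d m j \<tau> \<theta>
  proof -
    have "((\<lambda>r. Re (cis (- \<theta>) * (k2 (sample \<tau> r) (of_real r * cis \<theta>) / of_real (G r ^ m * r ^ j))))
        \<longlongrightarrow> Re (cis (- \<theta>) * (d * Complex (-1) \<tau> ^ m * cis (real j * \<theta>)))) (at_right 0)"
      by (intro tendsto_intros that)
    moreover have "cis (- \<theta>) * (d * Complex (-1) \<tau> ^ m * cis (real j * \<theta>))
        = d * Complex (-1) \<tau> ^ m * cis ((real j - 1) * \<theta>)"
    proof -
      have "cis (- \<theta>) * cis (real j * \<theta>) = cis ((real j - 1) * \<theta>)"
        unfolding cis_mult by (simp add: algebra_simps)
      then show ?thesis by (metis mult.assoc mult.commute)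
    qed
    ultimately show ?thesis unfolding N2_def by simp
  qed
  have ev_nz: "\<forall>\<^sub>F r in at_right 0. f r \<noteq> 0" if "(f \<longlongrightarrow> l) (at_right 0)" "l \<noteq> 0"
    for f :: "real \<Rightarrow> real" and l
    using tendsto_imp_eventually_ne[OF that] .
  show False
  proof (cases "\<exists>u\<in>ball 0 \<rho>. \<exists>z\<in>ball 0 \<rho>. k2 u z \<noteq> 0")
    case False
    then have k20: "k2 u z = 0" if "u \<in> ball 0 \<rho>" "z \<in> ball 0 \<rho>" for u z using that by blast
    have "\<exists>u\<in>ball 0 \<rho>. \<exists>z\<in>ball 0 \<rho>. k1 u z \<noteq> 0" using nz False by blast
    then obtain b k n where b: "b \<noteq> 0"
      "k = 0 \<Longrightarrow> n = 0 \<Longrightarrow> b = k1 0 0" "k = 0 \<Longrightarrow> n = 1 \<Longrightarrow> b = deriv (k1 0) 0"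
      and lim: "\<And>\<tau> \<theta>. ((\<lambda>r. k1 (sample \<tau> r) (of_real r * cis \<theta>) / of_real (G r ^ k * r ^ n))
        \<longlongrightarrow> b * Complex (-1) \<tau> ^ k * cis (real n * \<theta>)) (at_right 0)"
        by (rule sep_holo_sample_limit[OF k1 \<rho>]) (rule that, assumption+)
    have kn: "k \<noteq> 0 \<or> n \<noteq> 0" using b van by auto
    obtain \<tau> \<theta> where B: "Re (b * Complex (-1) \<tau> ^ k * cis (real n * \<theta>)) \<noteq> 0"
      using direction_both_nonzero[OF b(1) kn, of 1 1 1] by auto
    have "((\<lambda>r. complex_of_real r * cis \<theta>) \<longlongrightarrow> of_real 0 * cis \<theta>) (at_right 0)"
      by (intro tendsto_intros)
    then have "((\<lambda>r. complex_of_real r * cis \<theta>) \<longlongrightarrow> 0) (at_right 0)" by simp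
    from tendstoD[OF this \<rho>] tendstoD[OF sample_tendsto \<rho>, of \<tau>]
    have "\<forall>\<^sub>F r in at_right 0. N2 0 0 \<tau> \<theta> r = 0"
      by eventually_elim (simp add: N2_def k20)
    with eqN[of k n \<tau> \<theta> 0 0] ev_nz[OF lim1[OF lim] B] near0
    have "\<forall>\<^sub>F r in at_right (0::real). False"
    proof eventually_elim
      case (elim r)
      then have "G r > 0" using G_pos by blast
      then show ?case using elim by simp
    qed
    then show False by simp
  next
    case k2nz: True
    then obtain d m j where d: "d \<noteq> 0"
      "m = 0 \<Longrightarrow> j = 0 \<Longrightarrow> d = k2 0 0" "m = 0 \<Longrightarrow> j = 1 \<Longrightarrow> d = deriv (k2 0) 0"
      and limd: "\<And>\<tau> \<theta>. ((\<lambda>r. k2 (sample \<tau> r) (of_real r * cis \<theta>) / of_real (G r ^ m * r ^ j))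
        \<longlongrightarrow> d * Complex (-1) \<tau> ^ m * cis (real j * \<theta>)) (at_right 0)"
        by (rule sep_holo_sample_limit[OF k2 \<rho>]) (rule that, assumption+)
    have "m \<noteq> 0 \<or> j \<noteq> 1 \<or> Re d \<noteq> 0"
      using d(1,3) Im0 by (auto simp: complex_eq_iff)
    note dd = d(1) this
    show False
    proof (cases "\<exists>u\<in>ball 0 \<rho>. \<exists>z\<in>ball 0 \<rho>. k1 u z \<noteq> 0")
      case False
      then have k10: "k1 u z = 0" if "u \<in> ball 0 \<rho>" "z \<in> ball 0 \<rho>" for u z using that by blast
      obtain \<tau> \<theta> where D: "Re (d * Complex (-1) \<tau> ^ m * cis ((real j - 1) * \<theta>)) \<noteq> 0"
        by (rule direction_both_nonzero[of 1 1 1, OF _ _ dd]) (simp, simp, rule that)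
      have "((\<lambda>r. complex_of_real r * cis \<theta>) \<longlongrightarrow> of_real 0 * cis \<theta>) (at_right 0)"
        by (intro tendsto_intros)
      then have "((\<lambda>r. complex_of_real r * cis \<theta>) \<longlongrightarrow> 0) (at_right 0)" by simp
      from tendstoD[OF this \<rho>] tendstoD[OF sample_tendsto \<rho>, of \<tau>]
      have "\<forall>\<^sub>F r in at_right 0. N1 0 0 \<tau> \<theta> r = 0"
        by eventually_elim (simp add: N1_def k10)
      with eqN[of 0 0 \<tau> \<theta> m j] ev_nz[OF lim2[OF limd] D] near0
      have "\<forall>\<^sub>F r in at_right 0. \<bar>\<tau> * q' r + G' r / G r\<bar> \<le> 0 / r"
      proof eventually_elim
        case (elim r)
        then have "G r > 0" using G_pos by blast
        then have "X \<tau> r = 0" using elim by simp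
        then show ?case unfolding X_def by simp
      qed
      then show False by (rule log_derivative_bound_absurd)
    next
      case True
      then obtain b k n where b: "b \<noteq> 0"
        "k = 0 \<Longrightarrow> n = 0 \<Longrightarrow> b = k1 0 0" "k = 0 \<Longrightarrow> n = 1 \<Longrightarrow> b = deriv (k1 0) 0"
        and limb: "\<And>\<tau> \<theta>. ((\<lambda>r. k1 (sample \<tau> r) (of_real r * cis \<theta>) / of_real (G r ^ k * r ^ n))
          \<longlongrightarrow> b * Complex (-1) \<tau> ^ k * cis (real n * \<theta>)) (at_right 0)"
        by (rule sep_holo_sample_limit[OF k1 \<rho>]) (rule that, assumption+)
      have kn: "k \<noteq> 0 \<or> n \<noteq> 0" using b van by auto
      obtain \<tau> \<theta> where B: "Re (b * Complex (-1) \<tau> ^ k * cis (real n * \<theta>)) \<noteq> 0"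
        and D: "Re (d * Complex (-1) \<tau> ^ m * cis ((real j - 1) * \<theta>)) \<noteq> 0"
        by (rule direction_both_nonzero[OF b(1) kn dd]) (rule that)
      \<comment> \<open>\<open>y\<close> is the ratio of the two leading orders; it converges to the non-zero limit \<open>L\<close>.\<close>
      define L where "L = - Re (b * Complex (-1) \<tau> ^ k * cis (real n * \<theta>))
        / Re (d * Complex (-1) \<tau> ^ m * cis ((real j - 1) * \<theta>))"
      define y where "y \<tau> r = X \<tau> r * (G r ^ Suc m * r ^ j) / (G r ^ k * r ^ n)" for \<tau> r
      have L: "L \<noteq> 0" unfolding L_def using B D by simp
      have eqy: "\<forall>\<^sub>F r in at_right 0. N1 k n \<tau> \<theta> r + y \<tau> r * N2 m j \<tau> \<theta> r = 0" for \<tau> \<theta>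
        using eqN[of k n \<tau> \<theta> m j] near0
      proof eventually_elim
        case (elim r)
        have G: "G r ^ k * r ^ n \<noteq> 0" using G_pos[of r] elim by simp
        have "N1 k n \<tau> \<theta> r + y \<tau> r * N2 m j \<tau> \<theta> r = (N1 k n \<tau> \<theta> r * (G r ^ k * r ^ n)
            + X \<tau> r * (G r ^ Suc m * r ^ j) * N2 m j \<tau> \<theta> r) / (G r ^ k * r ^ n)"
          unfolding y_def add_divide_distrib using G by simp
        then show ?case unfolding elim(1) by simp
      qed
      have "((\<lambda>r. - N1 k n \<tau> \<theta> r / N2 m j \<tau> \<theta> r) \<longlongrightarrow> L) (at_right 0)"
        unfolding L_def by (intro tendsto_intros lim1 lim2 limb limd D)
      moreover have "\<forall>\<^sub>F r in at_right 0. - N1 k n \<tau> \<theta> r / N2 m j \<tau> \<theta> r = y \<tau> r"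
        using eqy[of \<tau> \<theta>] ev_nz[OF lim2[OF limd] D]
      proof eventually_elim
        case (elim r)
        then have eq: "- N1 k n \<tau> \<theta> r = y \<tau> r * N2 m j \<tau> \<theta> r" by linarith
        show ?case unfolding eq using elim by simp
      qed
      ultimately have ylim: "(y \<tau> \<longlongrightarrow> L) (at_right 0)" by (rule Lim_transform_eventually)
      have ybound: "\<forall>\<^sub>F r in at_right 0. \<bar>y \<tau> r\<bar> \<le> \<bar>L\<bar> + 1"
        using tendstoD[OF ylim, of 1] by (auto elim!: eventually_mono simp: dist_real_def)
      have pow1: "r ^ i \<le> 1" "0 \<le> r ^ i" if "0 < r" "r < 1" for r :: real and i
        using that by (auto intro: power_le_one)
      show False
      proof (cases "k \<le> m")
        case True
        \<comment> \<open>Here \<open>y\<close> has a factor \<open>\<tau> q' G + G'\<close>, which is flat, so \<open>y\<close> would tend to \<open>0\<close>.\<close>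
        have "((\<lambda>r. \<bar>\<tau>\<bar> * Q * (G r / r ^ n) + \<bar>G' r / r ^ n\<bar>)
            \<longlongrightarrow> \<bar>\<tau>\<bar> * Q * 0 + \<bar>0\<bar>) (at_right 0)"
          by (intro tendsto_intros G_over_power G'_over_power)
        then have dom: "((\<lambda>r. \<bar>\<tau>\<bar> * Q * (G r / r ^ n) + \<bar>G' r / r ^ n\<bar>) \<longlongrightarrow> 0) (at_right 0)"
          by simp
        have "\<forall>\<^sub>F r in at_right 0.
            norm (y \<tau> r) \<le> \<bar>\<tau>\<bar> * Q * (G r / r ^ n) + \<bar>G' r / r ^ n\<bar>"
          using eventually_G_small near0
        proof eventually_elim
          case (elim r)
          have XG: "X \<tau> r * G r = \<tau> * q' r * G r + G' r"
            unfolding X_def using elim by (simp add: field_simps)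
          have "G r ^ Suc m = G r * (G r ^ (m - k) * G r ^ k)"
            using True by (simp add: power_add[symmetric])
          then have "y \<tau> r = (X \<tau> r * G r) * (G r ^ (m - k) * r ^ j) / r ^ n"
            unfolding y_def using elim by simp
          then have "\<bar>y \<tau> r\<bar> = \<bar>X \<tau> r * G r\<bar> * (G r ^ (m - k) * r ^ j) / r ^ n"
            using elim by (simp add: abs_mult)
          also have "\<dots> \<le> \<bar>X \<tau> r * G r\<bar> * (1 * 1) / r ^ n"
            using elim pow1[of r j] pow1[of "G r" "m - k"]
            by (intro divide_right_mono mult_left_mono mult_mono) auto
          also have "\<dots> \<le> (\<bar>\<tau>\<bar> * Q * G r + \<bar>G' r\<bar>) / r ^ n"
          proof (intro divide_right_mono)
            have "\<bar>\<tau> * q' r * G r\<bar> = \<bar>\<tau>\<bar> * \<bar>q' r\<bar> * G r" using elim by (simp add: abs_mult)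
            also have "\<dots> \<le> \<bar>\<tau>\<bar> * Q * G r"
              using elim q'_bound[of r] by (intro mult_right_mono mult_left_mono) auto
            finally show "\<bar>X \<tau> r * G r\<bar> * (1 * 1) \<le> \<bar>\<tau>\<bar> * Q * G r + \<bar>G' r\<bar>"
              unfolding XG by simp
          qed (use elim in simp)
          finally show ?case using elim by (simp add: add_divide_distrib abs_divide)
        qed
        from Lim_null_comparison[OF this dom] have "(y \<tau> \<longlongrightarrow> 0) (at_right 0)" .
        then show False using L tendsto_unique[OF trivial_limit_at_right_real ylim] by blast
      next
        case km: False
        show False
        proof (cases "Suc (Suc m) \<le> k \<or> j \<le> Suc n")
          case True
          \<comment> \<open>Boundedness of \<open>y\<close> bounds \<open>G'/G\<close> by a multiple of \<open>1 / r\<close>.\<close>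
          have "((\<lambda>r. G r / r ^ j) \<longlongrightarrow> 0) (at_right 0)" by (rule G_over_power)
          then have "\<forall>\<^sub>F r in at_right 0. G r / r ^ j < 1" by (rule order_tendstoD) simp
          with ybound eventually_G_small near0
          have "\<forall>\<^sub>F r in at_right 0. \<bar>\<tau> * q' r + G' r / G r\<bar> \<le> (\<bar>L\<bar> + 1) / r"
          proof eventually_elim
            case (elim r)
            have "k = (k - Suc m) + Suc m" using km by simp
            then have Gk: "G r ^ k = G r ^ (k - Suc m) * G r ^ Suc m" by (metis power_add)
            have "X \<tau> r = y \<tau> r * (G r ^ (k - Suc m) * r ^ n / r ^ j)"
              unfolding y_def Gk using elim by simp
            then have X: "\<bar>X \<tau> r\<bar> = \<bar>y \<tau> r\<bar> * (G r ^ (k - Suc m) * r ^ n / r ^ j)"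
              using elim by (simp add: abs_mult)
            have "G r ^ (k - Suc m) * r ^ n / r ^ j \<le> 1 / r"
            proof (cases "Suc (Suc m) \<le> k")
              case True
              have "G r ^ (k - Suc m) \<le> G r ^ 1"
                using True elim by (intro power_decreasing) auto
              then have "G r ^ (k - Suc m) * r ^ n \<le> G r * 1"
                using elim pow1[of r n] by (intro mult_mono) auto
              then have "G r ^ (k - Suc m) * r ^ n / r ^ j \<le> G r * 1 / r ^ j"
                using elim by (intro divide_right_mono) auto
              also have "\<dots> \<le> 1" using elim by simp
              also have "\<dots> \<le> 1 / r" using elim by simp
              finally show ?thesis .
            next
              case False
              then have jn: "j \<le> Suc n" using \<open>Suc (Suc m) \<le> k \<or> j \<le> Suc n\<close> by blast
              have "G r ^ (k - Suc m) * r ^ n / r ^ j \<le> 1 * r ^ n / r ^ j"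
                using elim pow1[of "G r" "k - Suc m"]
                by (intro divide_right_mono mult_right_mono) auto
              also have "\<dots> \<le> 1 / r"
              proof -
                have "r ^ Suc n \<le> r ^ j" using jn elim by (intro power_decreasing) auto
                then show ?thesis using elim by (simp add: divide_le_eq le_divide_eq mult.commute)
              qed
              finally show ?thesis .
            qed
            then have "\<bar>y \<tau> r\<bar> * (G r ^ (k - Suc m) * r ^ n / r ^ j) \<le> (\<bar>L\<bar> + 1) * (1 / r)"
              using elim by (intro mult_mono) auto
            then show ?case unfolding X[symmetric] X_def by simp
          qed
          then show False by (rule log_derivative_bound_absurd)
        next
          case False
          then have kj: "k = Suc m" "n + 2 \<le> j" using km by auto
          \<comment> \<open>In this direction the limit of the equation is \<open>Re (b \<dots>) + L * 0 = 0\<close>. Replacing \<open>\<tau>\<close> by \<open>\<tau>'\<close>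
            does not change the limit of \<open>y\<close>, since \<open>q'\<close> is bounded and \<open>j > n\<close>.\<close>
          obtain \<tau>' \<theta>' where B': "Re (b * Complex (-1) \<tau>' ^ k * cis (real n * \<theta>')) \<noteq> 0"
            and D': "Re (d * Complex (-1) \<tau>' ^ m * cis ((real j - 1) * \<theta>')) = 0"
            by (rule direction_one_zero[OF b(1) kj(2)]) (rule that, unfold kj(1), assumption+)
          have "\<forall>\<^sub>F r in at_right 0. norm (y \<tau>' r - y \<tau> r) \<le> \<bar>\<tau>' - \<tau>\<bar> * Q * r"
            using near0
          proof eventually_elim
            case (elim r)
            have G: "G r > 0" using G_pos elim by blast
            have "j = Suc ((j - Suc n) + n)" using kj by simp
            then have rj: "r ^ j = r * (r ^ (j - Suc n) * r ^ n)" by (metis power_Suc power_add)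
            have y: "y t r = X t r * (r * r ^ (j - Suc n))" for t
              unfolding y_def kj(1) rj using G elim by simp
            have "y \<tau>' r - y \<tau> r = (\<tau>' - \<tau>) * q' r * (r * r ^ (j - Suc n))"
              unfolding y X_def by (simp add: algebra_simps)
            then have "norm (y \<tau>' r - y \<tau> r) = \<bar>\<tau>' - \<tau>\<bar> * \<bar>q' r\<bar> * (r * r ^ (j - Suc n))"
              using elim by (simp add: abs_mult)
            also have "\<dots> \<le> \<bar>\<tau>' - \<tau>\<bar> * Q * (r * 1)"
              using elim q'_bound[of r] pow1[of r "j - Suc n"] by (intro mult_mono) auto
            finally show ?case by simp
          qed
          moreover have "((\<lambda>r. \<bar>\<tau>' - \<tau>\<bar> * Q * r) \<longlongrightarrow> 0) (at_right 0)"
            by (rule tendsto_eq_intros refl | simp)+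
          ultimately have "((\<lambda>r. y \<tau>' r - y \<tau> r) \<longlongrightarrow> 0) (at_right 0)"
            by (rule Lim_null_comparison)
          from tendsto_add[OF this ylim] have "(y \<tau>' \<longlongrightarrow> L) (at_right 0)" by simp
          then have "((\<lambda>r. N1 k n \<tau>' \<theta>' r + y \<tau>' r * N2 m j \<tau>' \<theta>' r)
              \<longlongrightarrow> Re (b * Complex (-1) \<tau>' ^ k * cis (real n * \<theta>'))
                + L * Re (d * Complex (-1) \<tau>' ^ m * cis ((real j - 1) * \<theta>'))) (at_right 0)"
            by (intro tendsto_intros lim1 lim2 limb limd)
          from ev_nz[OF this] B' D'
          have "\<forall>\<^sub>F r in at_right 0. N1 k n \<tau>' \<theta>' r + y \<tau>' r * N2 m j \<tau>' \<theta>' r \<noteq> 0" by simp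
          with eqy[of \<tau>' \<theta>'] have "\<forall>\<^sub>F r in at_right (0::real). False"
            by eventually_elim simp
          then show False by simp
        qed
      qed
    qed
  qed
qed

end

section \<open>Wirtinger derivatives and logarithmic rescalings\<close>

text \<open>On \<open>T\<close>, inside the interior of \<open>S\<close>, the derivative within \<open>S\<close> is the ordinary one. It is bounded on
  \<open>K \<inter> T\<close> for every compact \<open>K \<subseteq> S\<close>, even if \<open>K\<close> contains boundary points of \<open>S\<close>.\<close>

lemma C1_smooth_on_deriv:
  fixes f :: "real \<Rightarrow> real"
  assumes "C1_smooth_on S f" "T \<subseteq> interior S"
  shows "\<And>x. x \<in> T \<Longrightarrow> (f has_real_derivative deriv f x) (at x)"
    and "\<And>K. compact K \<Longrightarrow> K \<subseteq> S \<Longrightarrow> \<exists>Q. \<forall>x\<in>K \<inter> T. \<bar>deriv f x\<bar> \<le> Q"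
proof -
  obtain D where D: "\<And>x. x \<in> S \<Longrightarrow> (f has_derivative blinfun_apply (D x)) (at x within S)"
    and cont: "continuous_on S D"
    using assms(1) unfolding C1_smooth_on_def by blast
  have der: "(f has_real_derivative D x 1) (at x)" if "x \<in> T" for x
  proof -
    have x: "x \<in> interior S" "x \<in> S" using that assms(2) interior_subset by auto
    then have "(f has_derivative blinfun_apply (D x)) (at x)"
      using D[of x] at_within_interior by metis
    moreover have "blinfun_apply (D x) = (*) (D x 1)"
    proof
      fix h :: real
      show "blinfun_apply (D x) h = D x 1 * h"
        using blinfun.scaleR_right[of "D x" h 1] by (simp add: mult.commute)
    qed
    ultimately show ?thesis unfolding has_field_derivative_def by simp
  qed
  then have eq: "deriv f x = D x 1" if "x \<in> T" for x using that DERIV_imp_deriv by blast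
  show "(f has_real_derivative deriv f x) (at x)" if "x \<in> T" for x
    using der[OF that] eq[OF that] by simp
  show "\<exists>Q. \<forall>x\<in>K \<inter> T. \<bar>deriv f x\<bar> \<le> Q" if K: "compact K" "K \<subseteq> S" for K
  proof -
    have "continuous_on K (\<lambda>x. D x 1)"
      using cont K(2) by (intro continuous_intros) (rule continuous_on_subset)
    then have "bounded ((\<lambda>x. D x 1) ` K)"
      using K(1) compact_continuous_image compact_imp_bounded by blast
    then obtain Q where "\<forall>x\<in>K. norm (D x 1) \<le> Q" unfolding bounded_iff by blast
    then show ?thesis using eq by (intro exI[of _ Q]) auto
  qed
qed

lemma Re_mult_wirtinger:
  fixes f :: "complex \<Rightarrow> real"
  assumes "(f has_derivative D) (at z)"
  shows "Re (h * wirtinger (\<lambda>w. of_real (f w)) z) = D h / 2"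
proof -
  have lin: "linear D" using assms has_derivative_linear by blast
  have dir: "vector_derivative (\<lambda>t::real. complex_of_real (f (z + v * of_real t))) (at 0) = of_real (D v)"
    for v
  proof -
    have "((\<lambda>t::real. z + v * of_real t) has_derivative (\<lambda>t. v * of_real t)) (at 0)"
      by (auto intro!: derivative_eq_intros)
    moreover have "(f has_derivative D) (at (z + v * of_real 0))" using assms by simp
    ultimately have "((\<lambda>t::real. f (z + v * of_real t)) has_derivative (\<lambda>t. D (v * of_real t))) (at 0)"
      using has_derivative_compose by fastforce
    then have "((\<lambda>t::real. complex_of_real (f (z + v * of_real t))) has_derivative
        (\<lambda>t. of_real (D (v * of_real t)))) (at 0)"
      by (rule has_derivative_of_real)
    moreover have "D (v * of_real t) = t *\<^sub>R D v" for t
      using linear_scale[OF lin, of t v] by (simp add: scaleR_conv_of_real mult.commute)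
    ultimately have "((\<lambda>t::real. complex_of_real (f (z + v * of_real t))) has_vector_derivative
        of_real (D v)) (at 0)"
      unfolding has_vector_derivative_def by (simp add: scaleR_conv_of_real)
    then show ?thesis by (rule vector_derivative_at)
  qed
  have "D h = D (Re h *\<^sub>R 1 + Im h *\<^sub>R \<i>)"
    by (metis complex_eq scaleR_conv_of_real mult.right_neutral mult.commute)
  also have "\<dots> = Re h * D 1 + Im h * D \<i>"
    by (simp add: linear_add[OF lin] linear_scale[OF lin])
  finally have "D h = Re h * D 1 + Im h * D \<i>" .
  then show ?thesis unfolding wirtinger_def using dir[of 1] dir[of \<i>] by simp
qed

lemma has_derivative_norm_complex:
  assumes "z \<noteq> 0"
  shows "(norm has_derivative (\<lambda>h. Re (cnj z * h) / norm z)) (at z)"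
proof -
  have "(norm has_derivative (\<lambda>h. inner (sgn z) h)) (at z)"
    using has_derivative_norm[OF assms] by (simp add: inner_commute)
  moreover have "inner (sgn z) h = Re (cnj z * h) / norm z" for h
    by (simp add: inner_complex_def sgn_div_norm add_divide_distrib divide_inverse algebra_simps)
  ultimately show ?thesis by simp
qed

text \<open>The coordinate \<open>w = (1 - exp(-\<alpha> z)) / \<alpha>\<close>, in which \<open>L\<^sup>\<alpha> \<partial>/\<partial>z\<close> becomes \<open>w \<partial>/\<partial>w\<close>, and its local inverse.
  Both are the identity for \<open>\<alpha> = 0\<close>.\<close>

definition flat_coord :: "real \<Rightarrow> complex \<Rightarrow> complex" where
  "flat_coord \<alpha> z = (if \<alpha> = 0 then z else (1 - exp (- of_real \<alpha> * z)) / of_real \<alpha>)"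

definition flat_coord_inv :: "real \<Rightarrow> complex \<Rightarrow> complex" where
  "flat_coord_inv \<alpha> w = (if \<alpha> = 0 then w else - Ln (1 - of_real \<alpha> * w) / of_real \<alpha>)"

lemma flat_coord_has_field_derivative:
  "(flat_coord \<alpha> has_field_derivative exp (- of_real \<alpha> * z)) (at z)"
proof (cases "\<alpha> = 0")
  case False
  then show ?thesis unfolding flat_coord_def by (auto intro!: derivative_eq_intros)
qed (simp add: flat_coord_def[abs_def])

lemma exp_mult_flat_coord: "exp (of_real \<alpha> * z) * flat_coord \<alpha> z = L_fun \<alpha> z"
  unfolding flat_coord_def L_fun_def by (simp add: exp_minus field_simps)

lemma flat_coord_zero [simp]: "flat_coord \<alpha> 0 = 0"
  by (simp add: flat_coord_def)

lemma flat_coord_inv_zero [simp]: "flat_coord_inv \<alpha> 0 = 0"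
  by (simp add: flat_coord_inv_def)

lemma flat_coord_flat_coord_inv:
  assumes "norm (of_real \<alpha> * w) < 1"
  shows "flat_coord \<alpha> (flat_coord_inv \<alpha> w) = w"
proof (cases "\<alpha> = 0")
  case False
  have "1 - of_real \<alpha> * w \<noteq> 0" using assms by auto
  then show ?thesis using False unfolding flat_coord_def flat_coord_inv_def by simp
qed (simp add: flat_coord_def flat_coord_inv_def)

lemma flat_coord_inv_flat_coord:
  assumes "norm (of_real \<alpha> * z) < 1"
  shows "flat_coord_inv \<alpha> (flat_coord \<alpha> z) = z"
proof (cases "\<alpha> = 0")
  case False
  have "\<bar>Im (- of_real \<alpha> * z)\<bar> < pi"
    using assms abs_Im_le_cmod[of "- of_real \<alpha> * z"] pi_gt3 by simp
  then have "Ln (exp (- of_real \<alpha> * z)) = - of_real \<alpha> * z" by (intro Ln_exp) auto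
  then show ?thesis using False unfolding flat_coord_def flat_coord_inv_def by simp
qed (simp add: flat_coord_def flat_coord_inv_def)

lemma flat_coord_inv_field_differentiable:
  assumes "norm (of_real \<alpha> * w) < 1"
  shows "flat_coord_inv \<alpha> field_differentiable (at w)"
proof (cases "\<alpha> = 0")
  case False
  have "Re (of_real \<alpha> * w) < 1" using assms complex_Re_le_cmod order.strict_trans1 by blast
  then have "1 - of_real \<alpha> * w \<notin> \<real>\<^sub>\<le>\<^sub>0" by (auto simp: complex_nonpos_Reals_iff)
  then have "(\<lambda>w. - Ln (1 - of_real \<alpha> * w) / of_real \<alpha>) field_differentiable (at w)"
    using False unfolding field_differentiable_def
    by (intro exI) (auto intro!: derivative_eq_intros)
  then show ?thesis using False unfolding flat_coord_inv_def[abs_def] by simp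
qed (simp add: flat_coord_inv_def[abs_def] field_differentiable_ident)

text \<open>The rescaling \<open>ln (1 + \<alpha> x) / \<alpha>\<close> of the real line near \<open>0\<close>, with limit \<open>x\<close> for \<open>\<alpha> = 0\<close>.\<close>

definition log_scale :: "real \<Rightarrow> real \<Rightarrow> real" where
  "log_scale \<alpha> x = (if \<alpha> = 0 then x else ln (1 + \<alpha> * x) / \<alpha>)"

lemma log_scale_eq_0_iff: "1 + \<alpha> * x > 0 \<Longrightarrow> log_scale \<alpha> x = 0 \<longleftrightarrow> x = 0"
  unfolding log_scale_def by auto

text \<open>At a zero of \<open>S\<close> the factor \<open>E\<close> need only be continuous.\<close>

lemma log_scale_has_derivative_at_zero:
  fixes E S :: "'a::real_normed_vector \<Rightarrow> real"
  assumes E: "isCont E x" and S: "(S has_derivative D) (at x)" and S0: "S x = 0"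
  shows "((\<lambda>y. log_scale \<alpha> (E y * S y)) has_derivative (\<lambda>h. E x * D h)) (at x)"
proof -
  have lin: "bounded_linear D" using S has_derivative_bounded_linear by blast
  have prod: "((\<lambda>y. E y * S y) has_derivative (\<lambda>h. E x * D h)) (at x)"
  proof -
    have "((\<lambda>y. E x * S y) has_derivative (\<lambda>h. E x * D h)) (at x)"
      using S by (rule has_derivative_mult_right)
    moreover have "((\<lambda>y. (E y - E x) * S y) has_derivative (\<lambda>h. 0)) (at x)"
    proof -
      obtain K where K: "\<And>h. norm (D h) \<le> norm h * K" using lin bounded_linear.bounded by blast
      have "((\<lambda>y. norm (S y - S x - D (y - x)) / norm (y - x)) \<longlongrightarrow> 0) (at x)"
        using S unfolding has_derivative_iff_norm by blast
      then have "((\<lambda>y. \<bar>E y - E x\<bar> * (norm (S y - S x - D (y - x)) / norm (y - x) + K))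
          \<longlongrightarrow> \<bar>E x - E x\<bar> * (0 + K)) (at x)"
        using E unfolding isCont_def by (intro tendsto_intros)
      then have "((\<lambda>y. \<bar>E y - E x\<bar> * (norm (S y - S x - D (y - x)) / norm (y - x) + K)) \<longlongrightarrow> 0) (at x)"
        by simp
      moreover have "\<forall>\<^sub>F y in at x. norm (norm ((E y - E x) * S y - (E x - E x) * S x - 0) / norm (y - x))
          \<le> \<bar>E y - E x\<bar> * (norm (S y - S x - D (y - x)) / norm (y - x) + K)"
        unfolding eventually_at_filter
      proof (intro always_eventually allI impI)
        fix y assume "y \<noteq> x"
        then have n: "norm (y - x) > 0" by simp
        have "\<bar>S y\<bar> \<le> norm (S y - S x - D (y - x)) + norm (y - x) * K"
          using K[of "y - x"] S0 by simp
        then have "\<bar>S y\<bar> / norm (y - x) \<le> (norm (S y - S x - D (y - x)) + norm (y - x) * K) / norm (y - x)"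
          using n by (intro divide_right_mono) auto
        also have "\<dots> = norm (S y - S x - D (y - x)) / norm (y - x) + K"
          using n by (simp add: add_divide_distrib)
        finally have "\<bar>E y - E x\<bar> * (\<bar>S y\<bar> / norm (y - x))
            \<le> \<bar>E y - E x\<bar> * (norm (S y - S x - D (y - x)) / norm (y - x) + K)"
          by (intro mult_left_mono) auto
        then show "norm (norm ((E y - E x) * S y - (E x - E x) * S x - 0) / norm (y - x))
          \<le> \<bar>E y - E x\<bar> * (norm (S y - S x - D (y - x)) / norm (y - x) + K)"
          by (simp add: abs_mult)
      qed
      ultimately have "((\<lambda>y. norm ((E y - E x) * S y - (E x - E x) * S x - 0) / norm (y - x)) \<longlongrightarrow> 0) (at x)"
        by (rule Lim_null_comparison[rotated])
      then show ?thesis unfolding has_derivative_iff_norm by simp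
    qed
    ultimately have "((\<lambda>y. E x * S y + (E y - E x) * S y) has_derivative (\<lambda>h. E x * D h + 0)) (at x)"
      by (rule has_derivative_add)
    then show ?thesis by (simp add: algebra_simps)
  qed
  have "(log_scale \<alpha> has_real_derivative 1) (at (E x * S x))"
  proof (cases "\<alpha> = 0")
    case False
    have "((\<lambda>x. ln (1 + \<alpha> * x) / \<alpha>) has_real_derivative 1) (at 0)"
      using False by (auto intro!: derivative_eq_intros)
    then show ?thesis using False S0 unfolding log_scale_def[abs_def] by simp
  qed (simp add: log_scale_def[abs_def])
  then have "(log_scale \<alpha> has_derivative (\<lambda>h. h)) (at (E x * S x))"
    unfolding has_field_derivative_def by (simp add: lambda_one)
  from has_derivative_compose[OF prod this] show ?thesis by simp
qed

lemma field_differentiable_compose_pair: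
  fixes f :: "complex \<times> complex \<Rightarrow> complex"
  assumes f: "(f has_derivative (\<lambda>(u, v). A * u + B * v)) (at (\<phi> x, \<psi> x))"
    and "\<phi> field_differentiable (at x)" "\<psi> field_differentiable (at x)"
  shows "(\<lambda>x. f (\<phi> x, \<psi> x)) field_differentiable (at x)"
proof -
  obtain \<phi>' \<psi>' where "(\<phi> has_field_derivative \<phi>') (at x)" "(\<psi> has_field_derivative \<psi>') (at x)"
    using assms(2,3) unfolding field_differentiable_def by blast
  then have "((\<lambda>x. (\<phi> x, \<psi> x)) has_derivative (\<lambda>h. (\<phi>' * h, \<psi>' * h))) (at x)"
    unfolding has_field_derivative_def by (rule has_derivative_Pair)
  from has_derivative_compose[OF this f]
  have "((\<lambda>x. f (\<phi> x, \<psi> x)) has_derivative (\<lambda>h. A * (\<phi>' * h) + B * (\<psi>' * h))) (at x)" by simp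
  moreover have "(\<lambda>h. A * (\<phi>' * h) + B * (\<psi>' * h)) = (*) (A * \<phi>' + B * \<psi>')"
    by (auto simp: algebra_simps)
  ultimately show ?thesis unfolding field_differentiable_def has_field_derivative_def by auto
qed

lemma eventually_nhds_0_prodE:
  assumes "\<forall>\<^sub>F x in nhds (0 :: complex \<times> complex). P (fst x) (snd x)"
  obtains \<rho> where "\<rho> > 0" "\<And>u v. u \<in> ball 0 \<rho> \<Longrightarrow> v \<in> ball 0 \<rho> \<Longrightarrow> P u v"
proof -
  obtain d where d: "d > 0" "\<And>x :: complex \<times> complex. dist x 0 < d \<Longrightarrow> P (fst x) (snd x)"
    using assms unfolding eventually_nhds_metric by blast
  have "P u v" if "u \<in> ball 0 (d / 2)" "v \<in> ball 0 (d / 2)" for u v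
  proof -
    have "norm (u, v) \<le> norm u + norm v" by (rule norm_Pair_le)
    then show ?thesis using d(2)[of "(u, v)"] that by simp
  qed
  then show ?thesis using that[of "d / 2"] d(1) by simp
qed

lemma tendsto_fst_snd_nhds_0:
  "(fst \<longlongrightarrow> (0::complex)) (nhds (0::complex \<times> complex))"
  "(snd \<longlongrightarrow> (0::complex)) (nhds (0::complex \<times> complex))"
  using tendsto_fst[OF filterlim_ident[of "nhds (0::complex \<times> complex)"]]
    tendsto_snd[OF filterlim_ident[of "nhds (0::complex \<times> complex)"]] by simp_all

lemma germ_0_eqI:
  assumes "\<forall>\<^sub>F z in nhds 0. H z = K z"
  shows "germ_0 H = germ_0 K"
proof -
  have "(\<forall>\<^sub>F z in nhds 0. X z = H z) \<longleftrightarrow> (\<forall>\<^sub>F z in nhds 0. X z = K z)" for X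
    using assms by (auto elim: eventually_elim2)
  then show ?thesis unfolding germ_0_def by blast
qed

section \<open>Straightening the model hypersurface\<close>

text \<open>The primitive \<open>A(z) = \<Sum> c\<^sub>n z\<^sup>n / n\<close> of \<open>a(z) / z = \<Sum> c\<^sub>n z\<^sup>n\<^sup>-\<^sup>1\<close>, the latter called \<open>dprim\<close>; both sums
  start at \<open>n = 1\<close>.\<close>

definition prim :: "(nat \<Rightarrow> complex) \<Rightarrow> complex \<Rightarrow> complex" where
  "prim c z = (\<Sum>n. c (Suc n) / of_nat (Suc n) * z ^ Suc n)"

definition dprim :: "(nat \<Rightarrow> complex) \<Rightarrow> complex \<Rightarrow> complex" where
  "dprim c z = (\<Sum>n. c (Suc n) * z ^ n)"

text \<open>The data of \<open>M(a, \<alpha>, p, q)\<close>. Holomorphy of \<open>a\<close> follows from its expansion in a power series.\<close>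

locale model_hypersurface =
  fixes \<alpha> \<epsilon>\<^sub>0 :: real and a :: "complex \<Rightarrow> complex" and c :: "nat \<Rightarrow> complex"
    and p q :: "real \<Rightarrow> real"
  assumes eps0: "\<epsilon>\<^sub>0 > 0"
    and a_sums: "\<And>z. z \<in> ball 0 \<epsilon>\<^sub>0 \<Longrightarrow> (\<lambda>n. c (Suc n) * z ^ Suc n) sums a z"
    and p_C1: "C1_smooth_on {0<..<\<epsilon>\<^sub>0} p"
    and q_C1: "C1_smooth_on {0..<\<epsilon>\<^sub>0} q"
    and q_0: "q 0 = 0"
    and g_flat: "flat_at_0 (g_fun p)"
    and g'_flat: "flat_at_0 (wirtinger (g_fun p))"
begin

lemma summable_prim:
  assumes "z \<in> ball 0 \<epsilon>\<^sub>0"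
  shows "summable (\<lambda>n. c (Suc n) / of_nat (Suc n) * z ^ Suc n)"
proof -
  obtain K where K: "norm z < K" "K < \<epsilon>\<^sub>0" using assms dense by auto
  define C where "C n = (if n = 0 then 0 else c n)" for n
  have "complex_of_real K \<in> ball 0 \<epsilon>\<^sub>0" using K norm_ge_zero[of z] by (simp del: norm_ge_zero)
  from sums_summable[OF a_sums[OF this]]
  have "summable (\<lambda>n. C (Suc n) * of_real K ^ Suc n)" unfolding C_def by simp
  then have "summable (\<lambda>n. C n * of_real K ^ n)" by (subst (asm) summable_Suc_iff)
  then have "summable (\<lambda>n. norm (C n * z ^ n))"
    by (rule powser_insidea) (use K norm_ge_zero[of z] in \<open>simp del: norm_ge_zero\<close>)
  then have s: "summable (\<lambda>n. norm (C (Suc n) * z ^ Suc n))" by (subst summable_Suc_iff)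
  show ?thesis
  proof (rule summable_comparison_test'[OF s])
    fix n :: nat
    have "norm (c (Suc n)) / real (Suc n) \<le> norm (c (Suc n)) / 1"
      by (intro divide_left_mono) auto
    then show "norm (c (Suc n) / of_nat (Suc n) * z ^ Suc n) \<le> norm (C (Suc n) * z ^ Suc n)"
      unfolding C_def norm_mult norm_divide norm_of_nat by (intro mult_right_mono) auto
  qed
qed

lemma prim_has_field_derivative:
  assumes "z \<in> ball 0 \<epsilon>\<^sub>0"
  shows "(prim c has_field_derivative dprim c z) (at z)"
proof -
  define C where "C n = (if n = 0 then 0 else c n / of_nat n)" for n
  have sm: "summable (\<lambda>n. C n * w ^ n)" if "norm w < \<epsilon>\<^sub>0" for w
  proof -
    have "summable (\<lambda>n. C (Suc n) * w ^ Suc n)"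
      using summable_prim[of w] that unfolding C_def by simp
    then show ?thesis by (subst (asm) summable_Suc_iff)
  qed
  have eq: "(\<Sum>n. C n * w ^ n) = prim c w" if "norm w < \<epsilon>\<^sub>0" for w
    using suminf_split_head[OF sm[OF that]] unfolding prim_def C_def by simp
  have "norm z < \<epsilon>\<^sub>0" using assms by simp
  from termdiffs_strong'[OF sm this]
  have "((\<lambda>w. \<Sum>n. C n * w ^ n) has_field_derivative (\<Sum>n. diffs C n * z ^ n)) (at z)" .
  moreover have "(\<Sum>n. diffs C n * z ^ n) = dprim c z"
    unfolding dprim_def diffs_def C_def by (simp del: of_nat_Suc)
  moreover have "\<forall>\<^sub>F w in nhds z. (\<Sum>n. C n * w ^ n) = prim c w"
    using eventually_nhds_in_open[OF open_ball assms] by eventually_elim (simp add: eq)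
  ultimately show ?thesis using DERIV_cong_ev[OF refl _ refl] by metis
qed

lemma prim_0 [simp]: "prim c 0 = 0"
  unfolding prim_def by simp

lemma prim_tendsto: "(prim c \<longlongrightarrow> 0) (nhds 0)"
  using DERIV_isCont[OF prim_has_field_derivative[of 0]] eps0
  by (simp add: isCont_def tendsto_nhds_iff)

lemma dprim_holomorphic: "dprim c holomorphic_on ball 0 \<epsilon>\<^sub>0"
proof -
  have "prim c holomorphic_on ball 0 \<epsilon>\<^sub>0"
    unfolding holomorphic_on_def field_differentiable_def
    using prim_has_field_derivative has_field_derivative_at_within by blast
  then have "deriv (prim c) holomorphic_on ball 0 \<epsilon>\<^sub>0"
    by (rule holomorphic_deriv) simp
  then show ?thesis
    by (rule holomorphic_transform) (rule DERIV_imp_deriv, rule prim_has_field_derivative)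
qed

lemma a_eq:
  assumes "z \<in> ball 0 \<epsilon>\<^sub>0"
  shows "a z = z * dprim c z"
proof (cases "z = 0")
  case True
  then show ?thesis using sums_unique[OF a_sums[OF assms]] by simp
next
  case False
  have s: "(\<lambda>n. z * (c (Suc n) * z ^ n)) sums a z"
    using a_sums[OF assms] by (simp add: mult_ac)
  from summable_mult_D[OF sums_summable[OF this] False]
  have "summable (\<lambda>n. c (Suc n) * z ^ n)" .
  from suminf_mult[OF this, of z] show ?thesis
    using sums_unique[OF s] unfolding dprim_def by simp
qed

lemma q_norm_continuous: "continuous_on (ball 0 \<epsilon>\<^sub>0) (\<lambda>z::complex. q (norm z))"
proof -
  have "q differentiable_on {0..<\<epsilon>\<^sub>0}"
    using q_C1 unfolding C1_smooth_on_def differentiable_on_def differentiable_def by blast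
  then have "continuous_on {0..<\<epsilon>\<^sub>0} q" by (rule differentiable_imp_continuous_on)
  then show ?thesis
    by (rule continuous_on_compose2) (auto intro!: continuous_intros)
qed

lemma prim_continuous: "continuous_on (ball 0 \<epsilon>\<^sub>0) (prim c)"
  by (intro continuous_at_imp_continuous_on ballI) (rule DERIV_isCont, erule prim_has_field_derivative)

lemma R_fun_eq: "R_fun c q z = q (norm z) - Re (prim c z)"
  unfolding R_fun_def prim_def ..

lemma R_fun_isCont:
  assumes "z \<in> ball 0 \<epsilon>\<^sub>0"
  shows "isCont (R_fun c q) z"
proof -
  have "continuous_on (ball 0 \<epsilon>\<^sub>0) (\<lambda>z. q (norm z) - Re (prim c z))"
    by (intro continuous_intros q_norm_continuous prim_continuous)
  then have "continuous_on (ball 0 \<epsilon>\<^sub>0) (R_fun c q)" unfolding R_fun_eq .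
  then show ?thesis using assms continuous_on_eq_continuous_at open_ball by blast
qed

lemma R_fun_0 [simp]: "R_fun c q 0 = 0"
  unfolding R_fun_eq by (simp add: q_0)

lemma q_deriv:
  "\<And>r. 0 < r \<Longrightarrow> r < \<epsilon>\<^sub>0 \<Longrightarrow> (q has_real_derivative deriv q r) (at r)"
  using C1_smooth_on_deriv(1)[OF q_C1, of "{0<..<\<epsilon>\<^sub>0}"] by (simp add: interior_atLeastLessThan)

lemma p_deriv:
  "\<And>r. 0 < r \<Longrightarrow> r < \<epsilon>\<^sub>0 \<Longrightarrow> (p has_real_derivative deriv p r) (at r)"
  using C1_smooth_on_deriv(1)[OF p_C1, of "{0<..<\<epsilon>\<^sub>0}"] by simp

lemma q_deriv_bounded: "\<exists>Q. \<forall>r. 0 < r \<longrightarrow> r < \<epsilon>\<^sub>0 / 2 \<longrightarrow> \<bar>deriv q r\<bar> \<le> Q"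
proof -
  have "\<exists>Q. \<forall>x\<in>{0..\<epsilon>\<^sub>0/2} \<inter> {0<..<\<epsilon>\<^sub>0}. \<bar>deriv q x\<bar> \<le> Q"
    by (rule C1_smooth_on_deriv(2)[OF q_C1])
       (use eps0 in \<open>auto simp: interior_atLeastLessThan\<close>)
  then obtain Q where "\<And>x. x \<in> {0..\<epsilon>\<^sub>0/2} \<inter> {0<..<\<epsilon>\<^sub>0} \<Longrightarrow> \<bar>deriv q x\<bar> \<le> Q" by blast
  then show ?thesis using eps0 by (intro exI[of _ Q]) auto
qed

lemma exp_p_has_derivative:
  assumes "z \<noteq> 0" "z \<in> ball 0 \<epsilon>\<^sub>0"
  shows "((\<lambda>w. exp (p (norm w))) has_derivative
      (\<lambda>h. deriv p (norm z) * exp (p (norm z)) * (Re (cnj z * h) / norm z))) (at z)"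
proof -
  have "((\<lambda>r. exp (p r)) has_real_derivative deriv p (norm z) * exp (p (norm z))) (at (norm z))"
    using assms by (auto intro!: derivative_eq_intros p_deriv)
  then show ?thesis
    unfolding has_field_derivative_def
    by (rule has_derivative_compose[OF has_derivative_norm_complex[OF assms(1)]])
qed

lemma q_norm_has_derivative:
  assumes "z \<noteq> 0" "z \<in> ball 0 \<epsilon>\<^sub>0"
  shows "((\<lambda>w. q (norm w)) has_derivative (\<lambda>h. deriv q (norm z) * (Re (cnj z * h) / norm z))) (at z)"
proof -
  have "(q has_real_derivative deriv q (norm z)) (at (norm z))"
    using assms by (intro q_deriv) auto
  then show ?thesis
    unfolding has_field_derivative_def
    by (rule has_derivative_compose[OF has_derivative_norm_complex[OF assms(1)]])
qed

lemma wirtinger_g_fun: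
  assumes "0 < r" "r < \<epsilon>\<^sub>0"
  shows "norm (wirtinger (g_fun p) (of_real r)) = \<bar>deriv p r * exp (p r)\<bar> / 2"
proof -
  have z: "complex_of_real r \<noteq> 0" "complex_of_real r \<in> ball 0 \<epsilon>\<^sub>0" using assms by auto
  define e where "e w = exp (p (norm w))" for w :: complex
  define D where "D h = deriv p r * exp (p r) * Re h" for h
  have "Re (cnj (complex_of_real r) * h) / norm (complex_of_real r) = Re h" for h
    using assms by simp
  then have "(e has_derivative D) (at (of_real r))"
    using exp_p_has_derivative[OF z] assms unfolding e_def D_def by simp
  note W = Re_mult_wirtinger[OF this]
  have ev: "\<forall>\<^sub>F t in nhds (0::real). g_fun p (of_real r + v * of_real t) = of_real (e (of_real r + v * of_real t))"
    for v
  proof -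
    have "((\<lambda>t::real. of_real r + v * of_real t) \<longlongrightarrow> of_real r + v * of_real 0) (nhds 0)"
      by (intro tendsto_intros filterlim_ident)
    then have "\<forall>\<^sub>F t::real in nhds 0. of_real r + v * of_real t \<noteq> 0"
      using assms by (intro tendsto_imp_eventually_ne) auto
    then show ?thesis by eventually_elim (simp add: g_fun_def e_def)
  qed
  have "vector_derivative (\<lambda>t::real. g_fun p (of_real r + v * of_real t)) (at 0)
      = vector_derivative (\<lambda>t::real. of_real (e (of_real r + v * of_real t))) (at 0)" for v
    using ev by (intro vector_derivative_cong_eq) auto
  from this[of 1] this[of \<i>]
  have "wirtinger (g_fun p) (of_real r) = wirtinger (\<lambda>w. of_real (e w)) (of_real r)"
    unfolding wirtinger_def by simp
  moreover have "wirtinger (\<lambda>w. of_real (e w)) (of_real r) = of_real (deriv p r * exp (p r) / 2)"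
  proof (rule complex_eqI)
    show "Re (wirtinger (\<lambda>w. of_real (e w)) (of_real r)) = Re (of_real (deriv p r * exp (p r) / 2))"
      using W[of 1] by (simp add: D_def)
    show "Im (wirtinger (\<lambda>w. of_real (e w)) (of_real r)) = Im (of_real (deriv p r * exp (p r) / 2))"
      using W[of \<i>] by (simp add: D_def)
  qed
  ultimately show ?thesis by (simp add: norm_of_real del: of_real_divide of_real_mult)
qed

lemma flat_at_right:
  assumes "flat_at_0 f"
  shows "\<exists>C. \<forall>\<^sub>F r in at_right 0. norm (f (of_real r)) \<le> C * r ^ N"
proof -
  obtain C e where e: "e > 0" and C: "\<And>z. norm z < e \<Longrightarrow> norm (f z) \<le> C * norm z ^ N"
    using assms unfolding flat_at_0_def by meson
  have "norm (f (of_real r)) \<le> C * r ^ N" if "0 < r" "r < e" for r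
    using C[of "of_real r"] that by simp
  then show ?thesis using e unfolding eventually_at_right_field by blast
qed

lemma flat_profile_obtain:
  obtains Q where "flat_profile (\<lambda>r. exp (p r)) (\<lambda>r. deriv p r * exp (p r)) q (deriv q) (\<epsilon>\<^sub>0 / 2) Q"
proof -
  obtain Q where Q: "\<And>r. 0 < r \<Longrightarrow> r < \<epsilon>\<^sub>0 / 2 \<Longrightarrow> \<bar>deriv q r\<bar> \<le> Q" using q_deriv_bounded by blast
  have small: "\<forall>\<^sub>F r in at_right 0. 0 < r \<and> r < \<epsilon>\<^sub>0"
    using eps0 unfolding eventually_at_right_field by blast
  have "flat_profile (\<lambda>r. exp (p r)) (\<lambda>r. deriv p r * exp (p r)) q (deriv q) (\<epsilon>\<^sub>0 / 2) Q"
  proof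
    show "\<epsilon>\<^sub>0 / 2 > 0" using eps0 by simp
    fix r assume r: "0 < r" "r < \<epsilon>\<^sub>0 / 2"
    show "exp (p r) > 0" by simp
    show "\<bar>deriv q r\<bar> \<le> Q" using Q r .
    show "((\<lambda>r. exp (p r)) has_real_derivative deriv p r * exp (p r)) (at r)"
      using r by (auto intro!: derivative_eq_intros p_deriv)
  next
    have "isCont (\<lambda>z::complex. q (norm z)) 0"
      using q_norm_continuous eps0 continuous_on_eq_continuous_at[OF open_ball]
      by (metis centre_in_ball)
    moreover have "((\<lambda>r. complex_of_real r) \<longlongrightarrow> 0) (at_right 0)"
      by (rule tendsto_eq_intros refl | simp)+
    ultimately have "((\<lambda>r. q (norm (complex_of_real r))) \<longlongrightarrow> q (norm (0::complex))) (at_right 0)"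
      by (rule isCont_tendsto_compose)
    then have "((\<lambda>r. q (norm (complex_of_real r))) \<longlongrightarrow> 0) (at_right 0)" by (simp add: q_0)
    moreover have "\<forall>\<^sub>F r in at_right 0. q (norm (complex_of_real r)) = q r"
      using small by eventually_elim simp
    ultimately show "(q \<longlongrightarrow> 0) (at_right 0)" by (rule Lim_transform_eventually)
  next
    fix N
    obtain C where "\<forall>\<^sub>F r in at_right 0. norm (g_fun p (of_real r)) \<le> C * r ^ N"
      using flat_at_right[OF g_flat] by blast
    with small have "\<forall>\<^sub>F r in at_right 0. exp (p r) \<le> C * r ^ N"
      by eventually_elim (simp add: g_fun_def)
    then show "\<exists>C. \<forall>\<^sub>F r in at_right 0. exp (p r) \<le> C * r ^ N" by blast
    obtain C where "\<forall>\<^sub>F r in at_right 0. norm (wirtinger (g_fun p) (of_real r)) \<le> C * r ^ N"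
      using flat_at_right[OF g'_flat] by blast
    with small have "\<forall>\<^sub>F r in at_right 0. \<bar>deriv p r * exp (p r)\<bar> \<le> (2 * C) * r ^ N"
      by eventually_elim (simp add: wirtinger_g_fun)
    then show "\<exists>C. \<forall>\<^sub>F r in at_right 0. \<bar>deriv p r * exp (p r)\<bar> \<le> C * r ^ N" by blast
  qed
  then show ?thesis using that by blast
qed

text \<open>The factor \<open>exp(\<i> (A(z) - q(|z|)))\<close>.\<close>

definition phase :: "complex \<Rightarrow> complex" where
  "phase z = exp (\<i> * (prim c z - of_real (q (norm z))))"

text \<open>The defining function \<open>Re (exp(-\<i> q(|z|)) u) + exp(p(|z|))\<close> with \<open>u = exp(\<i> A(z)) w\<close>, in the original
  coordinates. It is used only for \<open>z \<noteq> 0\<close>; the value \<open>p 0\<close> is arbitrary.\<close>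

definition \<Phi> :: "complex \<times> complex \<Rightarrow> real" where
  "\<Phi> x = Re (phase (snd x) * flat_coord \<alpha> (fst x)) + exp (p (norm (snd x)))"

text \<open>The factor by which \<open>\<rho>\<close> and \<open>\<Phi>\<close> differ up to \<open>log_scale\<close>.\<close>

definition E :: "complex \<times> complex \<Rightarrow> real" where
  "E x = exp (Im (prim c (snd x)) + \<alpha> * Re (fst x)) / cos (R_fun c q (snd x) + \<alpha> * Im (fst x))"

text \<open>The points at which the cosines and \<open>1 + \<alpha> P\<^sub>1\<close> are positive.\<close>

definition regular :: "complex \<times> complex \<Rightarrow> bool" where
  "regular x \<longleftrightarrow> snd x \<in> ball 0 \<epsilon>\<^sub>0 \<and> cos (R_fun c q (snd x)) > 0 \<and>
     cos (R_fun c q (snd x) + \<alpha> * Im (fst x)) > 0 \<and> 1 + \<alpha> * P1_fun c p q (snd x) > 0"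

lemma P1_fun_eq:
  assumes "z \<in> ball 0 \<epsilon>\<^sub>0" "z \<noteq> 0" "cos (R_fun c q z) > 0"
  shows "P1_fun c p q z = exp (p (norm z)) * exp (Im (prim c z)) / cos (R_fun c q z)"
proof -
  have "(\<Sum>n. c (Suc n) / (\<i> * of_nat (Suc n)) * z ^ Suc n)
      = (\<Sum>n. (- \<i>) * (c (Suc n) / of_nat (Suc n) * z ^ Suc n))"
    by (intro suminf_cong) (simp add: divide_inverse del: of_nat_Suc)
  also have "\<dots> = (- \<i>) * prim c z"
    unfolding prim_def by (rule suminf_mult[OF summable_prim[OF assms(1)]])
  finally have "Re (\<Sum>n. c (Suc n) / (\<i> * of_nat (Suc n)) * z ^ Suc n) = Im (prim c z)" by simp
  then show ?thesis using assms unfolding P1_fun_def by (simp add: exp_diff exp_add)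
qed

lemma phase_polar: "phase z = of_real (exp (- Im (prim c z))) * cis (- R_fun c q z)"
proof -
  have "phase z = of_real (exp (Re (\<i> * (prim c z - of_real (q (norm z))))))
      * cis (Im (\<i> * (prim c z - of_real (q (norm z)))))"
    unfolding phase_def by (rule exp_eq_polar)
  then show ?thesis by (simp add: R_fun_eq)
qed

text \<open>For \<open>\<alpha> \<noteq> 0\<close>, with \<open>z\<^sub>1 = s + \<i> t\<close>, both sides are \<open>1/\<alpha>\<close> times the logarithm of
  \<open>exp(\<alpha> s) (1 + \<alpha> P\<^sub>1) cos R / cos (R + \<alpha> t)\<close>.\<close>

lemma M_rho_eq_log_scale:
  assumes reg: "regular (w, z)" and z: "z \<noteq> 0"
  shows "M_rho c \<alpha> p q (w, z) = log_scale \<alpha> (E (w, z) * \<Phi> (w, z))"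
    and "1 + \<alpha> * (E (w, z) * \<Phi> (w, z)) > 0"
proof -
  define R where "R = R_fun c q z"
  define x where "x = exp (Im (prim c z))"
  define s where "s = Re w"
  define t where "t = Im w"
  define P where "P = exp (p (norm z))"
  have reg': "z \<in> ball 0 \<epsilon>\<^sub>0" "cos R > 0" "cos (R + \<alpha> * t) > 0" "1 + \<alpha> * P1_fun c p q z > 0"
    using reg unfolding regular_def R_def t_def by auto
  have x: "x > 0" unfolding x_def by simp
  have P1: "P1_fun c p q z = P * x / cos R"
    using P1_fun_eq[of z] reg' z unfolding R_def P_def x_def by simp
  have ph: "phase z = of_real (1 / x) * cis (- R)"
    unfolding phase_polar R_def x_def by (simp add: exp_minus inverse_eq_divide)
  have E: "E (w, z) = x * exp (\<alpha> * s) / cos (R + \<alpha> * t)"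
    unfolding E_def x_def R_def s_def t_def by (simp add: exp_add)
  have \<Phi>: "\<Phi> (w, z) = Re (cis (- R) * flat_coord \<alpha> w) / x + P"
    unfolding \<Phi>_def P_def by (simp add: ph Re_divide_of_real mult.assoc flip: of_real_divide)
  show "M_rho c \<alpha> p q (w, z) = log_scale \<alpha> (E (w, z) * \<Phi> (w, z))"
    and "1 + \<alpha> * (E (w, z) * \<Phi> (w, z)) > 0"
  proof (atomize (full), cases "\<alpha> = 0")
    case True
    have "Re (cis (- R) * flat_coord \<alpha> w) = cos R * s + sin R * t"
      using True by (simp add: flat_coord_def s_def t_def)
    then have "E (w, z) * \<Phi> (w, z) = s + P * x / cos R + tan R * t"
      unfolding E \<Phi> using True x reg'(2) by (simp add: tan_def field_simps)
    moreover have "M_rho c \<alpha> p q (w, z) = s + P * x / cos R + tan R * t"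
      using True P1 unfolding M_rho_def P_fun_def f_fun_def by (simp add: s_def t_def R_def)
    ultimately show "M_rho c \<alpha> p q (w, z) = log_scale \<alpha> (E (w, z) * \<Phi> (w, z)) \<and>
        1 + \<alpha> * (E (w, z) * \<Phi> (w, z)) > 0"
      using True by (simp add: log_scale_def)
  next
    case False
    define y where "y = R + \<alpha> * t"
    have "exp (- of_real \<alpha> * w) = of_real (exp (- \<alpha> * s)) * cis (- \<alpha> * t)"
      unfolding s_def t_def by (subst exp_eq_polar) simp
    then have "cis (- R) * flat_coord \<alpha> w
        = (cis (- R) - of_real (exp (- \<alpha> * s)) * (cis (- R) * cis (- \<alpha> * t))) / of_real \<alpha>"
      using False unfolding flat_coord_def by (simp add: algebra_simps)
    also have "cis (- R) * cis (- \<alpha> * t) = cis (- y)"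
      unfolding cis_mult y_def by (simp add: algebra_simps)
    finally have "Re (cis (- R) * flat_coord \<alpha> w) = (cos R - exp (- \<alpha> * s) * cos y) / \<alpha>"
      by (simp only: Re_divide_of_real) simp
    then have "Re (cis (- R) * flat_coord \<alpha> w)
        = (cos R - exp (- \<alpha> * s) * cos (R + \<alpha> * t)) / \<alpha>" unfolding y_def .
    then have "\<Phi> (w, z) = (cos R - exp (- \<alpha> * s) * cos (R + \<alpha> * t)) / \<alpha> / x + P"
      unfolding \<Phi> by (simp only:)
    then have "\<alpha> * \<Phi> (w, z) * x = cos R - exp (- \<alpha> * s) * cos (R + \<alpha> * t) + \<alpha> * (P * x)"
      using False x by (simp add: distrib_left distrib_right)
    also have "\<dots> = cos R * (1 + \<alpha> * P1_fun c p q z) - exp (- \<alpha> * s) * cos (R + \<alpha> * t)"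
      unfolding P1 using reg'(2) by (simp add: field_simps)
    finally have \<Phi>x: "\<alpha> * \<Phi> (w, z) * x
        = cos R * (1 + \<alpha> * P1_fun c p q z) - exp (- \<alpha> * s) * cos (R + \<alpha> * t)" .
    have "\<alpha> * (E (w, z) * \<Phi> (w, z)) = (\<alpha> * \<Phi> (w, z) * x) * exp (\<alpha> * s) / cos (R + \<alpha> * t)"
      unfolding E by simp
    also have "\<dots> = exp (\<alpha> * s) * cos R * (1 + \<alpha> * P1_fun c p q z) / cos (R + \<alpha> * t) - 1"
    proof -
      have "exp (- \<alpha> * s) * cos (R + \<alpha> * t) * exp (\<alpha> * s)
          = exp (- \<alpha> * s + \<alpha> * s) * cos (R + \<alpha> * t)"
        unfolding exp_add by (simp only: mult_ac)
      then have "exp (- \<alpha> * s) * cos (R + \<alpha> * t) * exp (\<alpha> * s) = cos (R + \<alpha> * t)" by simp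
      moreover have "cos (R + \<alpha> * t) / cos (R + \<alpha> * t) = 1" using reg'(3) by simp
      ultimately show ?thesis
        unfolding \<Phi>x left_diff_distrib diff_divide_distrib by (simp only: mult_ac)
    qed
    finally have eq: "1 + \<alpha> * (E (w, z) * \<Phi> (w, z))
        = exp (\<alpha> * s) * (1 + \<alpha> * P1_fun c p q z) / (cos (R + \<alpha> * t) / cos R)" by simp
    moreover have pos: "exp (\<alpha> * s) * (1 + \<alpha> * P1_fun c p q z) / (cos (R + \<alpha> * t) / cos R) > 0"
      using reg' by (intro divide_pos_pos mult_pos_pos) auto
    moreover have "ln (exp (\<alpha> * s) * (1 + \<alpha> * P1_fun c p q z) / (cos (R + \<alpha> * t) / cos R))
        = \<alpha> * s + ln (1 + \<alpha> * P1_fun c p q z) - ln (cos (R + \<alpha> * t) / cos R)"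
      using reg' by (simp add: ln_div ln_mult)
    moreover have "M_rho c \<alpha> p q (w, z)
        = (\<alpha> * s + ln (1 + \<alpha> * P1_fun c p q z) - ln (cos (R + \<alpha> * t) / cos R)) / \<alpha>"
    proof -
      have "\<bar>cos (R + \<alpha> * t) / cos R\<bar> = cos (R + \<alpha> * t) / cos R" using reg' by simp
      then show ?thesis
        using False unfolding M_rho_def P_fun_def f_fun_def R_def[symmetric]
        by (simp add: s_def[symmetric] t_def[symmetric] R_def[symmetric]
            add_divide_distrib diff_divide_distrib)
    qed
    ultimately show "M_rho c \<alpha> p q (w, z) = log_scale \<alpha> (E (w, z) * \<Phi> (w, z)) \<and>
        1 + \<alpha> * (E (w, z) * \<Phi> (w, z)) > 0"
      using False unfolding log_scale_def by simp
  qed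
qed

text \<open>The differential of \<open>\<Phi>\<close> at \<open>x\<close> applied to the real tangent vector \<open>(v1, v2)\<close>.\<close>

definition d\<Phi> :: "complex \<times> complex \<Rightarrow> complex \<Rightarrow> complex \<Rightarrow> real" where
  "d\<Phi> x v1 v2 =
     (let u = phase (snd x) * flat_coord \<alpha> (fst x); r = norm (snd x) in
      Re (phase (snd x) * exp (- of_real \<alpha> * fst x) * v1 + \<i> * dprim c (snd x) * u * v2)
      + (deriv q r * Im u + deriv p r * exp (p r)) * (Re (cnj (snd x) * v2) / r))"

lemma \<Phi>_has_derivative_fst:
  "((\<lambda>w. \<Phi> (w, z)) has_derivative (\<lambda>v. Re (phase z * exp (- of_real \<alpha> * w) * v))) (at w)"
proof -
  have "(flat_coord \<alpha> has_derivative (\<lambda>v. exp (- of_real \<alpha> * w) * v)) (at w)"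
    using flat_coord_has_field_derivative unfolding has_field_derivative_def .
  then have "((\<lambda>w. phase z * flat_coord \<alpha> w) has_derivative
      (\<lambda>v. phase z * (exp (- of_real \<alpha> * w) * v))) (at w)"
    by (rule has_derivative_mult_right)
  then have "((\<lambda>w. Re (phase z * flat_coord \<alpha> w)) has_derivative
      (\<lambda>v. Re (phase z * (exp (- of_real \<alpha> * w) * v)))) (at w)"
    by (rule has_derivative_Re)
  from has_derivative_add[OF this has_derivative_const[of "exp (p (norm z))"]]
  show ?thesis unfolding \<Phi>_def by (simp add: mult.assoc)
qed

lemma \<Phi>_has_derivative_snd:
  assumes z: "z \<in> ball 0 \<epsilon>\<^sub>0" "z \<noteq> 0"
  shows "((\<lambda>z. \<Phi> (w, z)) has_derivative (\<lambda>v. d\<Phi> (w, z) 0 v)) (at z)"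
proof -
  define D where "D v = Re (cnj z * v) / norm z" for v
  define u where "u = phase z * flat_coord \<alpha> w"
  have pr: "(prim c has_derivative (\<lambda>v. dprim c z * v)) (at z)"
    using prim_has_field_derivative[OF z(1)] unfolding has_field_derivative_def .
  have qn: "((\<lambda>z. q (norm z)) has_derivative (\<lambda>v. deriv q (norm z) * D v)) (at z)"
    using q_norm_has_derivative[OF z(2,1)] unfolding D_def .
  have "((\<lambda>z. \<i> * (prim c z - of_real (q (norm z)))) has_derivative
      (\<lambda>v. \<i> * (dprim c z * v - of_real (deriv q (norm z) * D v)))) (at z)"
    by (intro has_derivative_mult_right has_derivative_diff pr has_derivative_of_real qn)
  from has_derivative_compose[OF this DERIV_exp[unfolded has_field_derivative_def]]
  have "(phase has_derivative
      (\<lambda>v. phase z * (\<i> * (dprim c z * v - of_real (deriv q (norm z) * D v))))) (at z)"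
    unfolding phase_def[abs_def] .
  then have "((\<lambda>z. phase z * flat_coord \<alpha> w) has_derivative
      (\<lambda>v. phase z * (\<i> * (dprim c z * v - of_real (deriv q (norm z) * D v))) * flat_coord \<alpha> w)) (at z)"
    by (rule has_derivative_mult_left)
  then have "((\<lambda>z. Re (phase z * flat_coord \<alpha> w)) has_derivative
      (\<lambda>v. Re (phase z * (\<i> * (dprim c z * v - of_real (deriv q (norm z) * D v))) * flat_coord \<alpha> w))) (at z)"
    by (rule has_derivative_Re)
  from has_derivative_add[OF this exp_p_has_derivative[OF z(2,1)]]
  have "((\<lambda>z. \<Phi> (w, z)) has_derivative
      (\<lambda>v. Re (phase z * (\<i> * (dprim c z * v - of_real (deriv q (norm z) * D v))) * flat_coord \<alpha> w)
        + deriv p (norm z) * exp (p (norm z)) * D v)) (at z)"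
    unfolding \<Phi>_def D_def by simp
  moreover have "Re (phase z * (\<i> * (dprim c z * v - of_real (deriv q (norm z) * D v))) * flat_coord \<alpha> w)
        + deriv p (norm z) * exp (p (norm z)) * D v = d\<Phi> (w, z) 0 v" for v
  proof -
    have "phase z * (\<i> * (dprim c z * v - of_real (deriv q (norm z) * D v))) * flat_coord \<alpha> w
        = \<i> * dprim c z * u * v - \<i> * u * of_real (deriv q (norm z) * D v)"
      unfolding u_def by (simp add: algebra_simps)
    moreover have "Re (\<i> * u * of_real (deriv q (norm z) * D v)) = - (Im u * (deriv q (norm z) * D v))"
      by simp
    ultimately have "Re (phase z * (\<i> * (dprim c z * v - of_real (deriv q (norm z) * D v))) * flat_coord \<alpha> w)
        = Re (\<i> * dprim c z * u * v) + Im u * (deriv q (norm z) * D v)"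
      by (simp only: minus_complex.simps)
    then show ?thesis
      unfolding d\<Phi>_def Let_def D_def[symmetric] fst_conv snd_conv u_def[symmetric]
      by (simp add: algebra_simps)
  qed
  ultimately show ?thesis by simp
qed

text \<open>On the zero set the partial derivatives of \<open>\<rho>\<close> are those of \<open>\<Phi>\<close> multiplied by \<open>E > 0\<close>.\<close>

lemma tangency_iff:
  assumes reg: "\<forall>\<^sub>F y in nhds (w, z). regular y" and z: "z \<noteq> 0"
  shows "M_rho c \<alpha> p q (w, z) = 0 \<longleftrightarrow> \<Phi> (w, z) = 0"
    and "\<Phi> (w, z) = 0 \<Longrightarrow>
      Re (v1 * wirtinger1 (M_rho c \<alpha> p q) (w, z) + v2 * wirtinger2 (M_rho c \<alpha> p q) (w, z)) = 0
      \<longleftrightarrow> d\<Phi> (w, z) v1 v2 = 0"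
proof -
  have r: "regular (w, z)" using reg by (rule eventually_nhds_x_imp_x)
  then have zb: "z \<in> ball 0 \<epsilon>\<^sub>0" and cpos: "cos (R_fun c q z + \<alpha> * Im w) > 0"
    unfolding regular_def by auto
  have Epos: "E (w, z) > 0" using cpos unfolding E_def by simp
  show "M_rho c \<alpha> p q (w, z) = 0 \<longleftrightarrow> \<Phi> (w, z) = 0"
    using M_rho_eq_log_scale[OF r z] log_scale_eq_0_iff Epos by simp
  assume \<Phi>0: "\<Phi> (w, z) = 0"
  have ev1: "\<forall>\<^sub>F w' in nhds w. M_rho c \<alpha> p q (w', z) = log_scale \<alpha> (E (w', z) * \<Phi> (w', z))"
  proof -
    have "((\<lambda>w'. (w', z)) \<longlongrightarrow> (w, z)) (nhds w)" by (intro tendsto_intros filterlim_ident)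
    then have "\<forall>\<^sub>F w' in nhds w. regular (w', z)" using reg by (simp add: filterlim_iff)
    then show ?thesis by eventually_elim (rule M_rho_eq_log_scale(1)[OF _ z])
  qed
  have ev2: "\<forall>\<^sub>F z' in nhds z. M_rho c \<alpha> p q (w, z') = log_scale \<alpha> (E (w, z') * \<Phi> (w, z'))"
  proof -
    have "((\<lambda>z'. (w, z')) \<longlongrightarrow> (w, z)) (nhds z)" by (intro tendsto_intros filterlim_ident)
    then have "\<forall>\<^sub>F z' in nhds z. regular (w, z')" using reg by (simp add: filterlim_iff)
    moreover have "\<forall>\<^sub>F z' in nhds z. z' \<noteq> 0"
      using z by (intro tendsto_imp_eventually_ne[OF filterlim_ident]) auto
    ultimately show ?thesis by eventually_elim (rule M_rho_eq_log_scale(1))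
  qed
  have "isCont (\<lambda>w. E (w, z)) w"
    unfolding E_def using cpos by (auto intro!: continuous_intros)
  from log_scale_has_derivative_at_zero[OF this \<Phi>_has_derivative_fst \<Phi>0, of \<alpha>]
  have "((\<lambda>w. M_rho c \<alpha> p q (w, z)) has_derivative
      (\<lambda>v. E (w, z) * Re (phase z * exp (- of_real \<alpha> * w) * v))) (at w)"
    by (rule has_derivative_transform_eventually)
       (use ev1 eventually_nhds_x_imp_x[OF ev1] in \<open>auto simp: eventually_at_filter elim: eventually_mono\<close>)
  from Re_mult_wirtinger[OF this, of v1]
  have 1: "Re (v1 * wirtinger1 (M_rho c \<alpha> p q) (w, z))
      = E (w, z) / 2 * Re (phase z * exp (- of_real \<alpha> * w) * v1)"
    unfolding wirtinger1_def by simp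
  have "isCont (\<lambda>z. E (w, z)) z"
    unfolding E_def using cpos R_fun_isCont[OF zb] DERIV_isCont[OF prim_has_field_derivative[OF zb]]
    by (auto intro!: continuous_intros)
  from log_scale_has_derivative_at_zero[OF this \<Phi>_has_derivative_snd[OF zb z] \<Phi>0, of \<alpha>]
  have "((\<lambda>z. M_rho c \<alpha> p q (w, z)) has_derivative (\<lambda>v. E (w, z) * d\<Phi> (w, z) 0 v)) (at z)"
    by (rule has_derivative_transform_eventually)
       (use ev2 eventually_nhds_x_imp_x[OF ev2] in \<open>auto simp: eventually_at_filter elim: eventually_mono\<close>)
  from Re_mult_wirtinger[OF this, of v2]
  have 2: "Re (v2 * wirtinger2 (M_rho c \<alpha> p q) (w, z)) = E (w, z) / 2 * d\<Phi> (w, z) 0 v2"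
    unfolding wirtinger2_def by simp
  have "Re (v1 * wirtinger1 (M_rho c \<alpha> p q) (w, z) + v2 * wirtinger2 (M_rho c \<alpha> p q) (w, z))
      = E (w, z) / 2 * (Re (phase z * exp (- of_real \<alpha> * w) * v1) + d\<Phi> (w, z) 0 v2)"
    unfolding plus_complex.simps 1 2 by (simp only: distrib_left)
  also have "Re (phase z * exp (- of_real \<alpha> * w) * v1) + d\<Phi> (w, z) 0 v2 = d\<Phi> (w, z) v1 v2"
    unfolding d\<Phi>_def Let_def fst_conv snd_conv plus_complex.simps by simp
  finally have eq: "Re (v1 * wirtinger1 (M_rho c \<alpha> p q) (w, z) + v2 * wirtinger2 (M_rho c \<alpha> p q) (w, z))
      = E (w, z) / 2 * d\<Phi> (w, z) v1 v2" .
  show "Re (v1 * wirtinger1 (M_rho c \<alpha> p q) (w, z) + v2 * wirtinger2 (M_rho c \<alpha> p q) (w, z)) = 0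
      \<longleftrightarrow> d\<Phi> (w, z) v1 v2 = 0"
    unfolding eq using Epos by simp
qed

lemma eventually_regular: "\<forall>\<^sub>F x in nhds 0. regular x"
proof -
  note fs = tendsto_fst_snd_nhds_0
  have ball: "\<forall>\<^sub>F z in nhds (0::complex). z \<in> ball 0 \<epsilon>\<^sub>0"
    using eps0 by (intro eventually_nhds_in_open) auto
  have R0: "(R_fun c q \<longlongrightarrow> 0) (nhds 0)"
    using R_fun_isCont[of 0] eps0 by (simp add: isCont_def tendsto_nhds_iff)
  have cos0: "\<forall>\<^sub>F z in nhds 0. cos (R_fun c q z) > 0"
    by (rule order_tendstoD(1)[OF tendsto_cos[OF R0]]) simp
  obtain C e where e: "e > 0" and C: "\<And>z. norm z < e \<Longrightarrow> norm (g_fun p z) \<le> C * norm z ^ 1"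
    using g_flat unfolding flat_at_0_def by meson
  have P1: "(P1_fun c p q \<longlongrightarrow> 0) (nhds 0)"
  proof (rule Lim_null_comparison)
    have "((\<lambda>z. C * norm z ^ 1 * exp (Im (prim c z)) / cos (R_fun c q z))
        \<longlongrightarrow> C * norm (0::complex) ^ 1 * exp (Im 0) / cos 0) (nhds 0)"
      by (intro tendsto_intros filterlim_ident prim_tendsto R0) auto
    then show "((\<lambda>z. C * norm z ^ 1 * exp (Im (prim c z)) / cos (R_fun c q z)) \<longlongrightarrow> 0) (nhds 0)"
      by simp
    have "\<forall>\<^sub>F z in nhds (0::complex). z \<in> ball 0 e" using e by (intro eventually_nhds_in_open) auto
    with ball cos0 show "\<forall>\<^sub>F z in nhds 0. norm (P1_fun c p q z)
        \<le> C * norm z ^ 1 * exp (Im (prim c z)) / cos (R_fun c q z)"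
    proof eventually_elim
      case (elim z)
      show ?case
      proof (cases "z = 0")
        case False
        have "exp (p (norm z)) = norm (g_fun p z)" using False by (simp add: g_fun_def)
        also have "\<dots> \<le> C * norm z ^ 1" using C elim by simp
        finally have "exp (p (norm z)) * exp (Im (prim c z)) / cos (R_fun c q z)
            \<le> C * norm z ^ 1 * exp (Im (prim c z)) / cos (R_fun c q z)"
          using elim by (intro divide_right_mono mult_right_mono) auto
        moreover have "P1_fun c p q z = exp (p (norm z)) * exp (Im (prim c z)) / cos (R_fun c q z)"
          using P1_fun_eq elim False by blast
        ultimately show ?thesis using elim by simp
      qed (simp add: P1_fun_def)
    qed
  qed
  have "((\<lambda>z. 1 + \<alpha> * P1_fun c p q z) \<longlongrightarrow> 1 + \<alpha> * 0) (nhds 0)" by (intro tendsto_intros P1)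
  then have pos: "\<forall>\<^sub>F z in nhds 0. 1 + \<alpha> * P1_fun c p q z > 0"
    by (rule order_tendstoD(1)) simp
  have "\<forall>\<^sub>F x in nhds (0::complex \<times> complex). Q (snd x)" if "\<forall>\<^sub>F z in nhds 0. Q z" for Q :: "complex \<Rightarrow> bool"
    using fs(2) that by (simp add: filterlim_iff)
  note snds = this[OF ball] this[OF cos0] this[OF pos]
  have "((\<lambda>x. cos (R_fun c q (snd x) + \<alpha> * Im (fst x))) \<longlongrightarrow> cos (0 + \<alpha> * Im 0))
      (nhds (0::complex \<times> complex))"
    by (intro tendsto_intros fs filterlim_compose[OF R0])
  then have "\<forall>\<^sub>F x in nhds (0::complex \<times> complex). cos (R_fun c q (snd x) + \<alpha> * Im (fst x)) > 0"
    by (rule order_tendstoD(1)) simp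
  with snds show ?thesis unfolding regular_def by (simp add: eventually_conj_iff)
qed

text \<open>Points near the origin have a whole neighbourhood of regular points, as differentiation requires.\<close>

lemma eventually_eventually_regular: "\<forall>\<^sub>F x in nhds 0. \<forall>\<^sub>F y in nhds x. regular y"
  using eventually_regular by (simp add: eventually_eventually)

section \<open>Holomorphic fields tangent to the model hypersurface\<close>

lemma dprim_isCont: "z \<in> ball 0 \<epsilon>\<^sub>0 \<Longrightarrow> isCont (dprim c) z"
  using holomorphic_on_imp_continuous_on[OF dprim_holomorphic] continuous_on_eq_continuous_at[OF open_ball]
  by blast

text \<open>The point \<open>(z\<^sub>1, z\<^sub>2)\<close> with straightened coordinates \<open>u\<close> and \<open>z = z\<^sub>2\<close>.\<close>

definition pt :: "complex \<Rightarrow> complex \<Rightarrow> complex \<times> complex" where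
  "pt u z = (flat_coord_inv \<alpha> (exp (- \<i> * prim c z) * u), z)"

lemma pt_0 [simp]: "pt 0 z = (0, z)"
  by (simp add: pt_def)

lemma pt_tendsto:
  assumes "(f \<longlongrightarrow> 0) F" "(g \<longlongrightarrow> 0) F"
  shows "((\<lambda>x. pt (f x) (g x)) \<longlongrightarrow> 0) F"
proof -
  have "((\<lambda>x. exp (- \<i> * prim c (g x)) * f x) \<longlongrightarrow> exp (- \<i> * 0) * 0) F"
    by (intro tendsto_intros assms filterlim_compose[OF prim_tendsto])
  then have l: "((\<lambda>x. exp (- \<i> * prim c (g x)) * f x) \<longlongrightarrow> 0) F" by simp
  have "isCont (flat_coord_inv \<alpha>) 0"
    by (intro field_differentiable_imp_continuous_at flat_coord_inv_field_differentiable) simp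
  from isCont_tendsto_compose[OF this l]
  have "((\<lambda>x. pt (f x) (g x)) \<longlongrightarrow> (0, 0)) F"
    unfolding pt_def by (intro tendsto_intros assms) simp
  then show ?thesis by (simp add: zero_prod_def)
qed

text \<open>Tangency of \<open>v\<^sub>1 \<partial>/\<partial>z\<^sub>1 + v\<^sub>2 \<partial>/\<partial>z\<^sub>2\<close> at the sample points, written in the straightened coordinates; the
  factor of \<open>cis (- q)\<close> is the \<open>u\<close>-component of this vector.\<close>

lemma tangency_at_pt:
  assumes reg: "\<forall>\<^sub>F y in nhds (pt u z). regular y" and z: "z \<noteq> 0" "z \<in> ball 0 \<epsilon>\<^sub>0"
    and small: "norm (of_real \<alpha> * (exp (- \<i> * prim c z) * u)) < 1"
    and u: "cis (- q (norm z)) * u = Complex (-1) \<tau> * of_real (exp (p (norm z)))"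
    and tan: "M_rho c \<alpha> p q (pt u z) = 0 \<longrightarrow>
        Re (v1 * wirtinger1 (M_rho c \<alpha> p q) (pt u z) + v2 * wirtinger2 (M_rho c \<alpha> p q) (pt u z)) = 0"
  shows "Re (cis (- q (norm z)) * (exp (\<i> * prim c z) * exp (- of_real \<alpha> * fst (pt u z)) * v1
            + \<i> * dprim c z * u * v2))
      + (\<tau> * exp (p (norm z)) * deriv q (norm z) + deriv p (norm z) * exp (p (norm z)))
        * (Re (cnj z * v2) / norm z) = 0"
proof -
  define w where "w = fst (pt u z)"
  have ptw: "pt u z = (w, z)" unfolding w_def pt_def by simp
  have fw: "flat_coord \<alpha> w = exp (- \<i> * prim c z) * u"
    unfolding w_def pt_def using flat_coord_flat_coord_inv[OF small] by simp
  have ph: "phase z = cis (- q (norm z)) * exp (\<i> * prim c z)"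
    unfolding phase_def cis_conv_exp exp_add[symmetric] by (simp add: algebra_simps)
  have "exp (\<i> * prim c z) * exp (- \<i> * prim c z) = 1" by (simp flip: exp_add)
  then have "phase z * flat_coord \<alpha> w = cis (- q (norm z)) * u"
    unfolding ph fw by (metis mult.assoc mult.commute mult.left_neutral)
  then have pf: "phase z * flat_coord \<alpha> w = Complex (-1) \<tau> * of_real (exp (p (norm z)))"
    unfolding u .
  have "\<Phi> (w, z) = 0" unfolding \<Phi>_def fst_conv snd_conv pf by simp
  from tangency_iff[OF reg[unfolded ptw] z(1)] this tan[unfolded ptw]
  have "d\<Phi> (w, z) v1 v2 = 0" by blast
  note d\<Phi>0 = this[unfolded d\<Phi>_def Let_def fst_conv snd_conv pf]
  have eq: "phase z * exp (- of_real \<alpha> * w) * v1 + \<i> * dprim c z * (Complex (-1) \<tau> * of_real (exp (p (norm z)))) * v2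
      = cis (- q (norm z)) * (exp (\<i> * prim c z) * exp (- of_real \<alpha> * w) * v1 + \<i> * dprim c z * u * v2)"
    unfolding ph u[symmetric] by (simp add: algebra_simps)
  have "Im (Complex (-1) \<tau> * of_real (exp (p (norm z)))) = \<tau> * exp (p (norm z))" by simp
  then have Im: "deriv q (norm z) * Im (Complex (-1) \<tau> * of_real (exp (p (norm z))))
      = \<tau> * exp (p (norm z)) * deriv q (norm z)" by (simp only: mult_ac)
  show ?thesis using d\<Phi>0 unfolding eq Im w_def[symmetric] .
qed

lemma tangent_field_unique:
  assumes hol: "holomorphic_near_0 h1" "holomorphic_near_0 h2" and h0: "h1 0 = 0" "h2 0 = 0"
    and tan: "\<forall>\<^sub>F x in nhds 0. M_rho c \<alpha> p q x = 0 \<longrightarrow>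
        Re (h1 x * wirtinger1 (M_rho c \<alpha> p q) x + h2 x * wirtinger2 (M_rho c \<alpha> p q) x) = 0"
  obtains \<beta> :: real where "\<forall>\<^sub>F x in nhds 0. h1 x = of_real \<beta> * (L_fun \<alpha> (fst x) * a (snd x))
      \<and> h2 x = of_real \<beta> * (\<i> * snd x)"
proof -
  obtain U1 U2 where U: "open U1" "open U2" "0 \<in> U1" "0 \<in> U2"
    and d1: "\<And>x. x \<in> U1 \<Longrightarrow> \<exists>A B. (h1 has_derivative (\<lambda>(u, v). A * u + B * v)) (at x)"
    and d2: "\<And>x. x \<in> U2 \<Longrightarrow> \<exists>A B. (h2 has_derivative (\<lambda>(u, v). A * u + B * v)) (at x)"
    using hol unfolding holomorphic_near_0_def by meson
  define U where "U = U1 \<inter> U2"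
  have evU: "\<forall>\<^sub>F x in nhds 0. x \<in> U"
    unfolding U_def using U by (intro eventually_nhds_in_open) auto
  have cont: "(h1 \<longlongrightarrow> 0) (nhds 0)" "(h2 \<longlongrightarrow> 0) (nhds 0)"
    using d1[OF U(3)] d2[OF U(4)] has_derivative_continuous h0
    by (force simp: continuous_at tendsto_nhds_iff)+
  \<comment> \<open>\<open>k1\<close> and \<open>k2\<close> are the components of the field in the coordinates \<open>u\<close>, \<open>z\<close>, after subtraction of
    \<open>\<beta>\<close> times the rotation field \<open>\<i> z \<partial>/\<partial>z\<close>.\<close>
  define \<beta> where "\<beta> = Im (deriv (\<lambda>z. h2 (0, z)) 0)"
  define k1 where "k1 u z = exp (\<i> * prim c z) * exp (- of_real \<alpha> * fst (pt u z)) * h1 (pt u z)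
      + \<i> * dprim c z * u * h2 (pt u z)" for u z
  define k2 where "k2 u z = h2 (pt u z) - \<i> * of_real \<beta> * z" for u z
  note fs = tendsto_fst_snd_nhds_0
  have pt0: "((\<lambda>x. pt (fst x) (snd x)) \<longlongrightarrow> 0) (nhds 0)" by (rule pt_tendsto[OF fs])
  have ptx: "\<forall>\<^sub>F x in nhds 0. P (pt (fst x) (snd x))" if "\<forall>\<^sub>F x in nhds 0. P x" for P
    using pt0 that by (simp add: filterlim_iff)
  have ball: "\<forall>\<^sub>F x in nhds (0::complex \<times> complex). snd x \<in> ball 0 \<epsilon>\<^sub>0"
    using fs(2) eps0 by (intro topological_tendstoD) auto
  have small: "\<forall>\<^sub>F x in nhds (0::complex \<times> complex).
      norm (of_real \<alpha> * (exp (- \<i> * prim c (snd x)) * fst x)) < 1"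
  proof -
    have "((\<lambda>x. norm (of_real \<alpha> * (exp (- \<i> * prim c (snd x)) * fst x)))
        \<longlongrightarrow> norm (of_real \<alpha> * (exp (- \<i> * 0) * (0::complex)))) (nhds (0::complex \<times> complex))"
      by (intro tendsto_intros fs filterlim_compose[OF prim_tendsto])
    then show ?thesis by (rule order_tendstoD(2)) simp
  qed
  have dprim0: "(dprim c \<longlongrightarrow> dprim c 0) (nhds 0)"
    using dprim_isCont[of 0] eps0 by (simp add: isCont_def tendsto_nhds_iff)
  have k1b: "\<forall>\<^sub>F x in nhds (0::complex \<times> complex). norm (k1 (fst x) (snd x)) < 1"
  proof -
    have "((\<lambda>x. norm (k1 (fst x) (snd x))) \<longlongrightarrow> norm (exp (\<i> * 0)
        * exp (- of_real \<alpha> * fst (0::complex \<times> complex)) * 0 + \<i> * dprim c 0 * 0 * 0))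
        (nhds (0::complex \<times> complex))"
      unfolding k1_def
      by (intro tendsto_intros fs filterlim_compose[OF prim_tendsto] filterlim_compose[OF dprim0]
          filterlim_compose[OF cont(1)] filterlim_compose[OF cont(2)] pt0)
    then show ?thesis by (rule order_tendstoD(2)) simp
  qed
  have k2b: "\<forall>\<^sub>F x in nhds (0::complex \<times> complex). norm (k2 (fst x) (snd x)) < 1"
  proof -
    have "((\<lambda>x. norm (k2 (fst x) (snd x))) \<longlongrightarrow> norm (0 - \<i> * of_real \<beta> * (0::complex)))
        (nhds (0::complex \<times> complex))"
      unfolding k2_def by (intro tendsto_intros fs filterlim_compose[OF cont(2)] pt0)
    then show ?thesis by (rule order_tendstoD(2)) simp
  qed
  have "\<forall>\<^sub>F x in nhds (0::complex \<times> complex). pt (fst x) (snd x) \<in> U \<and> snd x \<in> ball 0 \<epsilon>\<^sub>0 \<and>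
      norm (of_real \<alpha> * (exp (- \<i> * prim c (snd x)) * fst x)) < 1 \<and>
      norm (k1 (fst x) (snd x)) < 1 \<and> norm (k2 (fst x) (snd x)) < 1"
    using ptx[OF evU] ball small k1b k2b by eventually_elim blast
  then obtain \<rho> where \<rho>: "\<rho> > 0" and near: "\<And>u z. u \<in> ball 0 \<rho> \<Longrightarrow> z \<in> ball 0 \<rho> \<Longrightarrow>
      pt u z \<in> U \<and> z \<in> ball 0 \<epsilon>\<^sub>0 \<and> norm (of_real \<alpha> * (exp (- \<i> * prim c z) * u)) < 1 \<and>
      norm (k1 u z) < 1 \<and> norm (k2 u z) < 1"
    by (rule eventually_nhds_0_prodE) (rule that)
  have w_u: "(\<lambda>u. fst (pt u z)) field_differentiable (at u)"
    if "u \<in> ball 0 \<rho>" "z \<in> ball 0 \<rho>" for u z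
  proof -
    have "(\<lambda>u. exp (- \<i> * prim c z) * u) field_differentiable (at u)"
      by (intro derivative_intros)
    from field_differentiable_compose[OF this flat_coord_inv_field_differentiable]
    show ?thesis using near[OF that] unfolding pt_def by (simp add: o_def)
  qed
  have w_z: "(\<lambda>z. fst (pt u z)) field_differentiable (at z)"
    if "u \<in> ball 0 \<rho>" "z \<in> ball 0 \<rho>" for u z
  proof -
    have "z \<in> ball 0 \<epsilon>\<^sub>0" using near[OF that] by blast
    from prim_has_field_derivative[OF this]
    have "(\<lambda>z. exp (- \<i> * prim c z) * u) field_differentiable (at z)"
      unfolding field_differentiable_def by (intro exI) (auto intro!: derivative_eq_intros)
    from field_differentiable_compose[OF this flat_coord_inv_field_differentiable]
    show ?thesis using near[OF that] unfolding pt_def by (simp add: o_def)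
  qed
  have h_u: "(\<lambda>u. h (pt u z)) holomorphic_on ball 0 \<rho>" and h_z: "(\<lambda>z. h (pt u z)) holomorphic_on ball 0 \<rho>"
    if h: "\<And>x. x \<in> U \<Longrightarrow> \<exists>A B. (h has_derivative (\<lambda>(u, v). A * u + B * v)) (at x)"
      and "u \<in> ball 0 \<rho>" "z \<in> ball 0 \<rho>" for h u z
  proof -
    have eq: "pt u z = (fst (pt u z), z)" for u z by (simp add: pt_def)
    have "(\<lambda>u. h (pt u z)) field_differentiable (at u)" "(\<lambda>z. h (pt u z)) field_differentiable (at z)"
      if uz: "u \<in> ball 0 \<rho>" "z \<in> ball 0 \<rho>" for u z
    proof -
      obtain A B where AB: "(h has_derivative (\<lambda>(u, v). A * u + B * v)) (at (fst (pt u z), z))"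
        using h[of "pt u z"] near[OF uz] eq by metis
      show "(\<lambda>u. h (pt u z)) field_differentiable (at u)"
        by (subst eq, rule field_differentiable_compose_pair[where x = u and \<psi> = "\<lambda>u. z", OF AB w_u[OF uz]])
           (rule field_differentiable_const)
      show "(\<lambda>z. h (pt u z)) field_differentiable (at z)"
        by (subst eq, rule field_differentiable_compose_pair[where x = z and \<psi> = "\<lambda>z. z"
              and \<phi> = "\<lambda>z. fst (pt u z)", OF AB w_z[OF uz]]) (rule field_differentiable_ident)
    qed
    then show "(\<lambda>u. h (pt u z)) holomorphic_on ball 0 \<rho>" "(\<lambda>z. h (pt u z)) holomorphic_on ball 0 \<rho>"
      using that(2,3) unfolding holomorphic_on_def by (auto intro: field_differentiable_at_within)
  qed
  have hU: "\<And>x. x \<in> U \<Longrightarrow> \<exists>A B. (h1 has_derivative (\<lambda>(u, v). A * u + B * v)) (at x)"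
    "\<And>x. x \<in> U \<Longrightarrow> \<exists>A B. (h2 has_derivative (\<lambda>(u, v). A * u + B * v)) (at x)"
    using d1 d2 unfolding U_def by auto
  have wu: "(\<lambda>u. fst (pt u z)) holomorphic_on ball 0 \<rho>" if "z \<in> ball 0 \<rho>" for z
    using w_u that unfolding holomorphic_on_def by (auto intro: field_differentiable_at_within)
  have wz: "(\<lambda>z. fst (pt u z)) holomorphic_on ball 0 \<rho>" if "u \<in> ball 0 \<rho>" for u
    using w_z that unfolding holomorphic_on_def by (auto intro: field_differentiable_at_within)
  have zero: "(0::complex) \<in> ball 0 \<rho>" using \<rho> by simp
  have sub: "ball (0::complex) \<rho> \<subseteq> ball 0 \<epsilon>\<^sub>0" using near[OF zero] by blast
  have prim_hol: "prim c holomorphic_on ball 0 \<rho>"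
    using prim_has_field_derivative sub unfolding holomorphic_on_def field_differentiable_def
    by (meson has_field_derivative_at_within subsetD)
  have dprim_hol: "dprim c holomorphic_on ball 0 \<rho>"
    using dprim_holomorphic sub by (rule holomorphic_on_subset)
  have s1: "sep_holo \<rho> k1"
    unfolding sep_holo_def
  proof (intro conjI ballI)
    show "(\<lambda>u. k1 u z) holomorphic_on ball 0 \<rho>" if "z \<in> ball 0 \<rho>" for z
      unfolding k1_def by (intro holomorphic_intros wu h_u[OF hU(1) zero] h_u[OF hU(2) zero] that)
    show "k1 u holomorphic_on ball 0 \<rho>" if "u \<in> ball 0 \<rho>" for u
      unfolding k1_def
      by (intro holomorphic_intros wz h_z[OF hU(1) _ zero] h_z[OF hU(2) _ zero] that prim_hol dprim_hol)
    show "\<exists>M. \<forall>u\<in>ball 0 \<rho>. \<forall>z\<in>ball 0 \<rho>. norm (k1 u z) \<le> M"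
      using near by (intro exI[of _ 1]) (auto simp: less_imp_le)
  qed
  have s2: "sep_holo \<rho> k2"
    unfolding sep_holo_def
  proof (intro conjI ballI)
    show "(\<lambda>u. k2 u z) holomorphic_on ball 0 \<rho>" if "z \<in> ball 0 \<rho>" for z
      unfolding k2_def by (intro holomorphic_intros h_u[OF hU(2) zero] that)
    show "k2 u holomorphic_on ball 0 \<rho>" if "u \<in> ball 0 \<rho>" for u
      unfolding k2_def by (intro holomorphic_intros h_z[OF hU(2) _ zero] that)
    show "\<exists>M. \<forall>u\<in>ball 0 \<rho>. \<forall>z\<in>ball 0 \<rho>. norm (k2 u z) \<le> M"
      using near by (intro exI[of _ 1]) (auto simp: less_imp_le)
  qed
  have k0: "k1 0 0 = 0" "k2 0 0 = 0"
    using h0 unfolding k1_def k2_def by (simp_all add: zero_prod_def)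
  have Im0: "Im (deriv (k2 0) 0) = 0"
  proof -
    have "(\<lambda>z. h2 (0, z)) holomorphic_on ball 0 \<rho>" using h_z[OF hU(2) zero zero] by simp
    then have "((\<lambda>z. h2 (0, z)) has_field_derivative deriv (\<lambda>z. h2 (0, z)) 0) (at 0)"
      by (rule holomorphic_derivI[OF _ open_ball zero])
    then have "(k2 0 has_field_derivative deriv (\<lambda>z. h2 (0, z)) 0 - \<i> * of_real \<beta>) (at 0)"
      unfolding k2_def pt_0 by (auto intro!: derivative_eq_intros)
    then have "deriv (k2 0) 0 = deriv (\<lambda>z. h2 (0, z)) 0 - \<i> * of_real \<beta>" by (rule DERIV_imp_deriv)
    then show ?thesis unfolding \<beta>_def by simp
  qed
  obtain Q where "flat_profile (\<lambda>r. exp (p r)) (\<lambda>r. deriv p r * exp (p r)) q (deriv q) (\<epsilon>\<^sub>0 / 2) Q"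
    by (rule flat_profile_obtain)
  then interpret fp: flat_profile "\<lambda>r. exp (p r)" "\<lambda>r. deriv p r * exp (p r)" q "deriv q" "\<epsilon>\<^sub>0 / 2" Q .
  have "\<forall>u\<in>ball 0 \<rho>. \<forall>z\<in>ball 0 \<rho>. k1 u z = 0 \<and> k2 u z = 0"
  proof (rule fp.tangency_rigidity[OF \<rho> s1 s2 k0 Im0])
    fix \<tau> \<theta> :: real
    have "((\<lambda>r. complex_of_real r * cis \<theta>) \<longlongrightarrow> of_real 0 * cis \<theta>) (at_right 0)"
      by (intro tendsto_intros)
    then have z0: "((\<lambda>r. complex_of_real r * cis \<theta>) \<longlongrightarrow> 0) (at_right 0)" by simp
    note u0 = fp.sample_tendsto[of \<tau>]
    have pt0: "((\<lambda>r. pt (fp.sample \<tau> r) (of_real r * cis \<theta>)) \<longlongrightarrow> 0) (at_right 0)"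
      by (rule pt_tendsto[OF u0 z0])
    have pt_ev: "\<forall>\<^sub>F r in at_right 0. P (pt (fp.sample \<tau> r) (of_real r * cis \<theta>))"
      if "\<forall>\<^sub>F x in nhds 0. P x" for P
      using pt0 that by (simp add: filterlim_iff)
    have "\<forall>\<^sub>F r in at_right 0. fp.sample \<tau> r \<in> ball 0 \<rho>" "\<forall>\<^sub>F r in at_right 0. of_real r * cis \<theta> \<in> ball 0 \<rho>"
      using tendstoD[OF u0 \<rho>] tendstoD[OF z0 \<rho>] by simp_all
    moreover have "\<forall>\<^sub>F r in at_right 0. \<forall>\<^sub>F y in nhds (pt (fp.sample \<tau> r) (of_real r * cis \<theta>)). regular y"
      by (rule pt_ev[OF eventually_eventually_regular])
    moreover note pt_ev[OF tan]
    ultimately show "\<forall>\<^sub>F r in at_right 0.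
        Re (cis (- q r) * k1 (fp.sample \<tau> r) (of_real r * cis \<theta>))
        + (\<tau> * exp (p r) * deriv q r + deriv p r * exp (p r))
          * Re (cis (- \<theta>) * k2 (fp.sample \<tau> r) (of_real r * cis \<theta>)) = 0"
      using fp.near0
    proof eventually_elim
      case (elim r)
      define u where "u = fp.sample \<tau> r"
      define z where "z = of_real r * cis \<theta>"
      have nz: "norm z = r" using elim unfolding z_def by (simp add: norm_mult)
      have z: "z \<noteq> 0" "z \<in> ball 0 \<epsilon>\<^sub>0" using nz elim by auto
      have "cis (- q r) * cis (q r) = 1" by (simp add: cis_mult)
      then have u: "cis (- q (norm z)) * u = Complex (-1) \<tau> * of_real (exp (p (norm z)))"
        unfolding u_def fp.sample_def nz by (metis mult.assoc mult.commute mult.left_neutral)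
      have sm: "norm (of_real \<alpha> * (exp (- \<i> * prim c z) * u)) < 1"
        using near[of u z] elim unfolding u_def z_def by blast
      note tan_pt = elim(4)[folded u_def z_def]
      have main: "Re (cis (- q r) * k1 u z)
          + (\<tau> * exp (p r) * deriv q r + deriv p r * exp (p r)) * (Re (cnj z * h2 (pt u z)) / r) = 0"
        using tangency_at_pt[OF elim(3)[folded u_def z_def] z sm u tan_pt] unfolding nz k1_def .
      have "cnj z = of_real r * cis (- \<theta>)" unfolding z_def by (simp add: cis_cnj)
      then have "Re (cnj z * h2 (pt u z)) / r = Re (cis (- \<theta>) * h2 (pt u z))"
        using elim by (simp add: mult.assoc)
      moreover have "cis (- \<theta>) * (\<i> * of_real \<beta> * z) = \<i> * of_real (\<beta> * r)"
      proof -
        have "cis (- \<theta>) * cis \<theta> = 1" by (simp add: cis_mult)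
        then show ?thesis unfolding z_def by (simp add: algebra_simps)
      qed
      then have "Re (cis (- \<theta>) * k2 u z) = Re (cis (- \<theta>) * h2 (pt u z))"
        unfolding k2_def right_diff_distrib by (simp only: minus_complex.simps) simp
      ultimately show ?case using main unfolding u_def z_def by simp
    qed
  qed
  then have van: "k1 u z = 0" "k2 u z = 0" if "u \<in> ball 0 \<rho>" "z \<in> ball 0 \<rho>" for u z
    using that by blast+
  \<comment> \<open>Transport \<open>k1 = k2 = 0\<close> back to the original coordinates.\<close>
  have fc: "(flat_coord \<alpha> \<longlongrightarrow> 0) (nhds 0)"
    using DERIV_isCont[OF flat_coord_has_field_derivative[of \<alpha> 0]]
    by (simp add: isCont_def tendsto_nhds_iff)
  have "((\<lambda>x. exp (\<i> * prim c (snd x)) * flat_coord \<alpha> (fst x)) \<longlongrightarrow> exp (\<i> * 0) * 0)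
      (nhds (0::complex \<times> complex))"
    by (intro tendsto_intros filterlim_compose[OF prim_tendsto] filterlim_compose[OF fc] fs)
  then have "\<forall>\<^sub>F x in nhds (0::complex \<times> complex). exp (\<i> * prim c (snd x)) * flat_coord \<alpha> (fst x) \<in> ball 0 \<rho>"
    by (rule topological_tendstoD) (use \<rho> in auto)
  moreover have "\<forall>\<^sub>F x in nhds (0::complex \<times> complex). snd x \<in> ball 0 \<rho>"
    using fs(2) by (rule topological_tendstoD) (use \<rho> in auto)
  moreover have "\<forall>\<^sub>F x in nhds (0::complex \<times> complex). norm (of_real \<alpha> * fst x) < 1"
  proof -
    have "((\<lambda>x. norm (of_real \<alpha> * fst x)) \<longlongrightarrow> norm (of_real \<alpha> * (0::complex))) (nhds (0::complex \<times> complex))"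
      by (intro tendsto_intros fs)
    then show ?thesis by (rule order_tendstoD(2)) simp
  qed
  ultimately have "\<forall>\<^sub>F x in nhds 0. h1 x = of_real \<beta> * (L_fun \<alpha> (fst x) * a (snd x))
      \<and> h2 x = of_real \<beta> * (\<i> * snd x)"
  proof eventually_elim
    case (elim x)
    obtain w z where x: "x = (w, z)" by fastforce
    define u where "u = exp (\<i> * prim c z) * flat_coord \<alpha> w"
    have ub: "u \<in> ball 0 \<rho>" "z \<in> ball 0 \<rho>" using elim unfolding x u_def by auto
    have "exp (- \<i> * prim c z) * exp (\<i> * prim c z) = 1" by (simp flip: exp_add)
    then have "exp (- \<i> * prim c z) * u = flat_coord \<alpha> w"
      unfolding u_def by (metis mult.assoc mult.left_neutral)
    then have ptx: "pt u z = (w, z)"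
      unfolding pt_def using flat_coord_inv_flat_coord[of \<alpha> w] elim x by simp
    have h2: "h2 (w, z) = \<i> * of_real \<beta> * z" using van(2)[OF ub] unfolding k2_def ptx by simp
    have az: "a z = z * dprim c z" using a_eq sub ub by blast
    have "0 = exp (\<i> * prim c z) * exp (- of_real \<alpha> * w) * h1 (w, z) + \<i> * dprim c z * u * (\<i> * of_real \<beta> * z)"
      using van(1)[OF ub] unfolding k1_def ptx h2 fst_conv by simp
    also have "\<dots> = exp (\<i> * prim c z) * exp (- of_real \<alpha> * w) * h1 (w, z) - of_real \<beta> * a z * u"
    proof -
      have "\<i> * dprim c z * u * (\<i> * of_real \<beta> * z) = (\<i> * \<i>) * (of_real \<beta> * (z * dprim c z) * u)"
        by (simp only: mult_ac)
      then show ?thesis unfolding az by simp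
    qed
    finally have "exp (\<i> * prim c z) * (exp (- of_real \<alpha> * w) * h1 (w, z))
        = exp (\<i> * prim c z) * (of_real \<beta> * a z * flat_coord \<alpha> w)"
      unfolding u_def by (simp add: algebra_simps)
    then have "exp (- of_real \<alpha> * w) * h1 (w, z) = of_real \<beta> * a z * flat_coord \<alpha> w" by simp
    then have "exp (of_real \<alpha> * w) * (exp (- of_real \<alpha> * w) * h1 (w, z))
        = of_real \<beta> * a z * (exp (of_real \<alpha> * w) * flat_coord \<alpha> w)"
      by (simp only: mult_ac)
    moreover have "exp (of_real \<alpha> * w) * (exp (- of_real \<alpha> * w) * h1 (w, z)) = h1 (w, z)"
      by (simp add: mult.assoc[symmetric] exp_minus)
    ultimately have "h1 (w, z) = of_real \<beta> * a z * L_fun \<alpha> w"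
      unfolding exp_mult_flat_coord by simp
    then show ?case using h2 unfolding x by simp
  qed
  then show ?thesis by (rule that)
qed

lemma H_field_eq: "H_field a \<alpha> x = (L_fun \<alpha> (fst x) * a (snd x), \<i> * snd x)"
  unfolding H_field_def by (simp add: case_prod_unfold)

lemma H_field_tangent: "tangent_0 (\<lambda>x. \<beta> *\<^sub>R H_field a \<alpha> x) (M_rho c \<alpha> p q)"
  unfolding tangent_0_def
  using eventually_eventually_regular eventually_regular
proof eventually_elim
  case (elim x)
  obtain w z where x: "x = (w, z)" by fastforce
  have zb: "z \<in> ball 0 \<epsilon>\<^sub>0" using elim unfolding x regular_def by auto
  have az: "a z = z * dprim c z" by (rule a_eq[OF zb])
  show ?case
  \<comment> \<open>The derivatives of the defining function play no role where \<open>z\<^sub>2 = 0\<close>: the field vanishes there.\<close>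
  proof (cases "z = 0")
    case True
    then show ?thesis using az unfolding x H_field_eq by simp
  next
    case False
    define v1 where "v1 = of_real \<beta> * (L_fun \<alpha> w * a z)"
    define v2 where "v2 = of_real \<beta> * (\<i> * z)"
    have "exp (- of_real \<alpha> * w) * L_fun \<alpha> w = flat_coord \<alpha> w"
      unfolding exp_mult_flat_coord[symmetric] mult.assoc[symmetric] by (simp flip: exp_add)
    then have "phase z * exp (- of_real \<alpha> * w) * v1 = of_real \<beta> * phase z * flat_coord \<alpha> w * (z * dprim c z)"
      unfolding v1_def az by (metis (no_types, opaque_lifting) mult.assoc mult.commute)
    moreover have "\<i> * dprim c z * (phase z * flat_coord \<alpha> w) * v2
        = (\<i> * \<i>) * (of_real \<beta> * phase z * flat_coord \<alpha> w * (z * dprim c z))"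
      unfolding v2_def by (simp only: mult_ac)
    ultimately have "phase z * exp (- of_real \<alpha> * w) * v1
        + \<i> * dprim c z * (phase z * flat_coord \<alpha> w) * v2 = 0" by simp
    moreover have "Re (cnj z * v2) = 0" unfolding v2_def by (simp add: algebra_simps)
    ultimately have "d\<Phi> (w, z) v1 v2 = 0" unfolding d\<Phi>_def Let_def fst_conv snd_conv by simp
    with tangency_iff[OF elim(1)[unfolded x] False]
    have "M_rho c \<alpha> p q (w, z) = 0 \<longrightarrow>
        Re (v1 * wirtinger1 (M_rho c \<alpha> p q) (w, z) + v2 * wirtinger2 (M_rho c \<alpha> p q) (w, z)) = 0"
      by blast
    then show ?thesis
      unfolding x H_field_eq v1_def v2_def by (simp only: scaleR_Pair fst_conv snd_conv scaleR_conv_of_real)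
  qed
qed

lemma L_fun_has_field_derivative: "(L_fun \<alpha> has_field_derivative exp (of_real \<alpha> * z)) (at z)"
proof (cases "\<alpha> = 0")
  case False
  then show ?thesis unfolding L_fun_def by (auto intro!: derivative_eq_intros)
qed (simp add: L_fun_def[abs_def])

lemma H_field_holomorphic:
  "holomorphic_near_0 (fst \<circ> (\<lambda>x. \<beta> *\<^sub>R H_field a \<alpha> x))"
  "holomorphic_near_0 (snd \<circ> (\<lambda>x. \<beta> *\<^sub>R H_field a \<alpha> x))"
proof -
  define U where "U = (UNIV :: complex set) \<times> ball (0::complex) \<epsilon>\<^sub>0"
  have U: "open U" "0 \<in> U" unfolding U_def using eps0 by (auto intro: open_Times simp: zero_prod_def)
  have eq: "fst \<circ> (\<lambda>x. \<beta> *\<^sub>R H_field a \<alpha> x) = (\<lambda>x. of_real \<beta> * (L_fun \<alpha> (fst x) * a (snd x)))"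
    "snd \<circ> (\<lambda>x. \<beta> *\<^sub>R H_field a \<alpha> x) = (\<lambda>x. of_real \<beta> * (\<i> * snd x))"
    by (auto simp: fun_eq_iff H_field_eq scaleR_conv_of_real)
  have "(\<lambda>z. z * dprim c z) holomorphic_on ball 0 \<epsilon>\<^sub>0"
    by (intro holomorphic_intros dprim_holomorphic)
  then have a_hol: "a holomorphic_on ball 0 \<epsilon>\<^sub>0"
    by (rule holomorphic_transform) (simp add: a_eq)
  have "\<exists>A B. ((\<lambda>x. of_real \<beta> * (L_fun \<alpha> (fst x) * a (snd x))) has_derivative (\<lambda>(u, v). A * u + B * v)) (at x)"
    if "x \<in> U" for x
  proof -
    have "snd x \<in> ball 0 \<epsilon>\<^sub>0" using that unfolding U_def by auto
    then have "(a has_field_derivative deriv a (snd x)) (at (snd x))"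
      by (rule holomorphic_derivI[OF a_hol open_ball])
    then have "((\<lambda>x. a (snd x)) has_derivative (\<lambda>v. deriv a (snd x) * snd v)) (at x)"
      unfolding has_field_derivative_def
      by (rule has_derivative_compose[OF has_derivative_snd[OF has_derivative_ident]])
    moreover have "((\<lambda>x. L_fun \<alpha> (fst x)) has_derivative (\<lambda>v. exp (of_real \<alpha> * fst x) * fst v)) (at x)"
      by (rule has_derivative_compose[OF has_derivative_fst[OF has_derivative_ident]
          L_fun_has_field_derivative[unfolded has_field_derivative_def]])
    ultimately have "((\<lambda>x. of_real \<beta> * (L_fun \<alpha> (fst x) * a (snd x))) has_derivative
        (\<lambda>v. of_real \<beta> * (L_fun \<alpha> (fst x) * (deriv a (snd x) * snd v)
          + exp (of_real \<alpha> * fst x) * fst v * a (snd x)))) (at x)"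
      by (intro has_derivative_mult_right has_derivative_mult)
    moreover have "(\<lambda>v. of_real \<beta> * (L_fun \<alpha> (fst x) * (deriv a (snd x) * snd v)
          + exp (of_real \<alpha> * fst x) * fst v * a (snd x)))
        = (\<lambda>(u, v). (of_real \<beta> * exp (of_real \<alpha> * fst x) * a (snd x)) * u
          + (of_real \<beta> * L_fun \<alpha> (fst x) * deriv a (snd x)) * v)"
      by (auto simp: fun_eq_iff algebra_simps)
    ultimately show ?thesis by metis
  qed
  then show "holomorphic_near_0 (fst \<circ> (\<lambda>x. \<beta> *\<^sub>R H_field a \<alpha> x))"
    unfolding holomorphic_near_0_def eq using U by blast
  have "((\<lambda>x. of_real \<beta> * (\<i> * snd x)) has_derivative (\<lambda>(u, v). 0 * u + of_real \<beta> * \<i> * v)) (at x)"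
    for x :: "complex \<times> complex"
  proof -
    have "((\<lambda>x. of_real \<beta> * (\<i> * snd x)) has_derivative (\<lambda>v. of_real \<beta> * (\<i> * snd v))) (at x)"
      by (intro has_derivative_mult_right has_derivative_snd has_derivative_ident)
    then show ?thesis by (simp add: case_prod_unfold mult.assoc)
  qed
  then show "holomorphic_near_0 (snd \<circ> (\<lambda>x. \<beta> *\<^sub>R H_field a \<alpha> x))"
    unfolding holomorphic_near_0_def eq by blast
qed

lemma hol_0_model_hypersurface:
  "hol_0 (M_rho c \<alpha> p q) = {germ_0 (\<lambda>z. \<beta> *\<^sub>R H_field a \<alpha> z) | \<beta>::real. True}"
proof (intro equalityI subsetI)
  fix G assume "G \<in> hol_0 (M_rho c \<alpha> p q)"
  then obtain H where G: "G = germ_0 H" and hol: "holomorphic_near_0 (fst \<circ> H)" "holomorphic_near_0 (snd \<circ> H)"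
    and H0: "H 0 = 0" and tan: "tangent_0 H (M_rho c \<alpha> p q)"
    unfolding hol_0_def by blast
  obtain \<beta> :: real where "\<forall>\<^sub>F x in nhds 0. (fst \<circ> H) x = of_real \<beta> * (L_fun \<alpha> (fst x) * a (snd x))
      \<and> (snd \<circ> H) x = of_real \<beta> * (\<i> * snd x)"
    by (rule tangent_field_unique[OF hol]) (use H0 tan in \<open>auto simp: tangent_0_def\<close>)
  then have "\<forall>\<^sub>F x in nhds 0. H x = \<beta> *\<^sub>R H_field a \<alpha> x"
    by eventually_elim (simp add: H_field_eq scaleR_conv_of_real prod_eq_iff)
  then have "G = germ_0 (\<lambda>z. \<beta> *\<^sub>R H_field a \<alpha> z)" unfolding G by (rule germ_0_eqI)
  then show "G \<in> {germ_0 (\<lambda>z. \<beta> *\<^sub>R H_field a \<alpha> z) | \<beta>::real. True}" by blast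
next
  fix G assume "G \<in> {germ_0 (\<lambda>z. \<beta> *\<^sub>R H_field a \<alpha> z) | \<beta>::real. True}"
  then obtain \<beta> :: real where G: "G = germ_0 (\<lambda>z. \<beta> *\<^sub>R H_field a \<alpha> z)" by blast
  have "\<beta> *\<^sub>R H_field a \<alpha> 0 = 0"
    using a_eq[of 0] eps0 unfolding H_field_eq by (simp add: zero_prod_def)
  then show "G \<in> hol_0 (M_rho c \<alpha> p q)"
    unfolding hol_0_def G using H_field_holomorphic H_field_tangent by blast
qed

end

theorem corollary2:
  fixes \<alpha> \<epsilon>\<^sub>0 :: real
    and a :: "complex \<Rightarrow> complex"
    and c :: "nat \<Rightarrow> complex"
    and p q :: "real \<Rightarrow> real"
  assumes "\<epsilon>\<^sub>0 > 0"
    and "a holomorphic_on ball 0 \<epsilon>\<^sub>0"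
    and "\<And>z. z \<in> ball 0 \<epsilon>\<^sub>0 \<Longrightarrow> (\<lambda>n. c (Suc n) * z ^ Suc n) sums a z"
    and "\<exists>z\<in>ball 0 \<epsilon>\<^sub>0. a z \<noteq> 0"
    and "C1_smooth_on {0<..<\<epsilon>\<^sub>0} p"
    and "C1_smooth_on {0..<\<epsilon>\<^sub>0} q"
    and "q 0 = 0"
    and "C1_smooth_on (ball 0 \<epsilon>\<^sub>0) (g_fun p)"
    and "flat_at_0 (g_fun p)"
    and "flat_at_0 (wirtinger (g_fun p))"
    and "C1_smooth_near 0 (R_fun c q)"
  shows "hol_0 (M_rho c \<alpha> p q) = {germ_0 (\<lambda>z. \<beta> *\<^sub>R H_field a \<alpha> z) | \<beta>::real. True}"
proof -
  interpret model_hypersurface \<alpha> \<epsilon>\<^sub>0 a c p q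
    using assms by unfold_locales
  show ?thesis by (rule hol_0_model_hypersurface)
qed

end
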